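(* Let $\mathbb{T}$ be a dependent type theory with the axioms for identity types, let $\mathcal{C}(\mathbb{T})$ be its classifying category, and let $\mathcal{D}$ be the class of display maps in $\mathcal{C}(\mathbb{T})$. Put $\mathcal{A} := {}^\pitchfork\mathcal{D}$ (the maps having the left lifting property with respect to every display map) and $\mathcal{B} := \mathcal{A}^\pitchfork$ (the maps having the right lifting property with respect to every map in $\mathcal{A}$). Then $(\mathcal{A},\mathcal{B})$ is a weak factorisation system on $\mathcal{C}(\mathbb{T})$, i.e. (1) every map $f$ factors as $f = p i$ with $i\in\mathcal{A}$, $p\in\mathcal{B}$, and (2) $\mathcal{A}^\pitchfork=\mathcal{B}$ and $\mathcal{A}={}^\pitchfork\mathcal{B}$.
   Context: $\mathbb{T}$ is a Martin-Löf style dependent type theory with judgements $A\in\mathrm{Type}$, $a\in A$, $A=B\in\mathrm{Type}$, $a=b\in A$ (possibly relative to a context), containing the standard structural rules (variable rule, weakening, substitution, reflexivity/symmetry/transitivity of definitional equality, and the compatibility rules "if $a\in A$ and $A=B$ then $a\in B$", likewise for $a=b$). Its identity types are given by: formation ($A$ a type, $a,b\in A$ give a type $\mathrm{Id}_A(a,b)$); introduction ($a\in A$ gives $\mathrm{r}(a)\in\mathrm{Id}_A(a,a)$); elimination: given $p\in\mathrm{Id}_A(a,b)$, a dependent context $\Theta(x,y,u)$ relative to $(x\in A,y\in A,u\in\mathrm{Id}_A(x,y))$, a type $C(x,y,u)$ in context $(x\in A,y\in A,u\in \mathrm{Id}_A(x,y),\Theta(x,y,u))$, and $d(x)\in C(x,x,\mathrm{r}(x))$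 in context $(x\in A,\Theta(x,x,\mathrm{r}(x)))$, one gets $\mathrm{J}(a,b,p,d)\in C(a,b,p)$ in context $\Theta(a,b,p)$; computation: $\mathrm{J}(a,a,\mathrm{r}(a),d)=d(a)$ in context $\Theta(a,a,\mathrm{r}(a))$. All these rules hold relative to an arbitrary ambient context $\Gamma$ and commute with substitution ($\mathrm{Id}$, $\mathrm{r}$ and $\mathrm{J}$ are stable under substitution). The reflection rules (that $p\in\mathrm{Id}(a,b)$ implies $a=b$) are not assumed. A context is a list $(x_0\in A_0, x_1\in A_1(x_0),\dots,x_n\in A_n(x_0,\dots,x_{n-1}))$ of well-formed variable declarations. A context morphism $f:\Phi\to\Psi$ with $\Psi=(y_0\in B_0,\dots,y_m\in B_m(\dots))$ is a tuple $(b_0,\dots,b_m)$ with $(\Phi)\ b_i\in B_i(b_0,\dots,b_{i-1})$ derivable. The classifying category $\mathcal{C}(\mathbb{T})$ has as objects contexts up to renaming of variables and componentwise definitional equality, as morphisms context morphisms up to renaming and pointwise definitional equality, composition given by substitution. A display map is a morphism $(\Gamma,x\in A)\to\Gamma$ projecting away the last variable, where $A$ is a type in context $\Gamma$. For maps $f:A\to B$, $g:C\to D$, $f\pitchfork g$ means every commutative square $g h = k f$ has a diagonal $j:B\to C$ with $jf=h$, $gj=k$. *)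

theory Defs
  imports Main
begin

section \<open>Categories, lifting properties and weak factorisation systems\<close>

record ('o, 'm) cat =
  ob :: "'o set"
  ar :: "'m set"
  src :: "'m \<Rightarrow> 'o"
  tgt :: "'m \<Rightarrow> 'o"
  ident :: "'o \<Rightarrow> 'm"
  cmp :: "'m \<Rightarrow> 'm \<Rightarrow> 'm"    \<comment> \<open>\<open>cmp C g f\<close> is \<open>g\<close> after \<open>f\<close>\<close>

definition hom_set :: "('o, 'm) cat \<Rightarrow> 'o \<Rightarrow> 'o \<Rightarrow> 'm set" where
  "hom_set C X Y = {f \<in> ar C. src C f = X \<and> tgt C f = Y}"

locale category =
  fixes C :: "('o, 'm) cat"
  assumes src_ob: "f \<in> ar C \<Longrightarrow> src C f \<in> ob C"
    and tgt_ob: "f \<in> ar C \<Longrightarrow> tgt C f \<in> ob C"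
    and ident_hom: "X \<in> ob C \<Longrightarrow> ident C X \<in> hom_set C X X"
    and cmp_hom: "f \<in> hom_set C X Y \<Longrightarrow> g \<in> hom_set C Y Z \<Longrightarrow> cmp C g f \<in> hom_set C X Z"
    and cmp_ident_right: "f \<in> hom_set C X Y \<Longrightarrow> cmp C f (ident C X) = f"
    and cmp_ident_left: "f \<in> hom_set C X Y \<Longrightarrow> cmp C (ident C Y) f = f"
    and cmp_assoc: "f \<in> hom_set C X Y \<Longrightarrow> g \<in> hom_set C Y Z \<Longrightarrow> h \<in> hom_set C Z W \<Longrightarrow>
      cmp C h (cmp C g f) = cmp C (cmp C h g) f"

definition lifts :: "('o, 'm) cat \<Rightarrow> 'm \<Rightarrow> 'm \<Rightarrow> bool" where
  "lifts C f g \<longleftrightarrow>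
    (\<forall>h \<in> hom_set C (src C f) (src C g). \<forall>k \<in> hom_set C (tgt C f) (tgt C g).
      cmp C g h = cmp C k f \<longrightarrow>
      (\<exists>j \<in> hom_set C (tgt C f) (src C g). cmp C j f = h \<and> cmp C g j = k))"

definition llp :: "('o, 'm) cat \<Rightarrow> 'm set \<Rightarrow> 'm set" where
  "llp C R = {f \<in> ar C. \<forall>g \<in> R. lifts C f g}"

definition rlp :: "('o, 'm) cat \<Rightarrow> 'm set \<Rightarrow> 'm set" where
  "rlp C L = {g \<in> ar C. \<forall>f \<in> L. lifts C f g}"

locale weak_factorisation_system = category C
  for C :: "('o, 'm) cat" +
  fixes L R :: "'m set"
  assumes left_ar: "L \<subseteq> ar C"
    and right_ar: "R \<subseteq> ar C"
    and factorisation: "f \<in> ar C \<Longrightarrow>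
      \<exists>i \<in> L. \<exists>p \<in> R. src C i = src C f \<and> tgt C i = src C p \<and> tgt C p = tgt C f \<and> f = cmp C p i"
    and rlp_left: "rlp C L = R"
    and llp_right: "llp C R = L"


section \<open>Raw syntax\<close>

text \<open>Type and term expressions over an arbitrary supply \<open>'f\<close> of operation symbols, with de Bruijn
  indices, so that expressions are identified up to renaming of variables. An argument \<open>(k, e)\<close> of an
  operation symbol is an expression \<open>e\<close> in which \<open>k\<close> further variables are bound.\<close>

datatype 'f expr = Var nat | Op 'f "(nat \<times> 'f expr) list"

definition up_ren :: "nat \<Rightarrow> (nat \<Rightarrow> nat) \<Rightarrow> nat \<Rightarrow> nat" where
  "up_ren k \<rho> i = (if i < k then i else \<rho> (i - k) + k)"

fun rename :: "(nat \<Rightarrow> nat) \<Rightarrow> 'f expr \<Rightarrow> 'f expr" where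
  "rename \<rho> (Var i) = Var (\<rho> i)"
| "rename \<rho> (Op f es) = Op f (map (\<lambda>(k, e). (k, rename (up_ren k \<rho>) e)) es)"

definition weaken :: "nat \<Rightarrow> 'f expr \<Rightarrow> 'f expr" where
  "weaken k = rename (\<lambda>i. i + k)"

definition up :: "nat \<Rightarrow> (nat \<Rightarrow> 'f expr) \<Rightarrow> nat \<Rightarrow> 'f expr" where
  "up k \<sigma> i = (if i < k then Var i else weaken k (\<sigma> (i - k)))"

fun subst :: "(nat \<Rightarrow> 'f expr) \<Rightarrow> 'f expr \<Rightarrow> 'f expr" where
  "subst \<sigma> (Var i) = \<sigma> i"
| "subst \<sigma> (Op f es) = Op f (map (\<lambda>(k, e). (k, subst (up k \<sigma>) e)) es)"

fun scoped :: "nat \<Rightarrow> 'f expr \<Rightarrow> bool" where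
  "scoped n (Var i) \<longleftrightarrow> i < n"
| "scoped n (Op f es) \<longleftrightarrow> (\<forall>(k, e) \<in> set es. scoped (n + k) e)"

text \<open>The substitution of a tuple of terms for the most recently declared variables; the variables
  declared before these are kept. Tuples are listed in the same order as contexts below, so that
  the term substituted for the variable \<open>Var 0\<close> comes first.\<close>

definition tup :: "'f expr list \<Rightarrow> nat \<Rightarrow> 'f expr" where
  "tup ts i = (if i < length ts then ts ! i else Var (i - length ts))"


section \<open>Contexts and judgements\<close>

text \<open>The context \<open>(x\<^sub>0 \<in> A\<^sub>0, \<dots>, x\<^sub>n \<in> A\<^sub>n)\<close> is the list \<open>[A\<^sub>n, \<dots>, A\<^sub>0]\<close>: the last declaration comes
  first, and \<open>Var i\<close> refers to the entry with index \<open>i\<close>. Thus \<open>A # \<Gamma>\<close> is \<open>(\<Gamma>, x \<in> A)\<close> and, for a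
  dependent context \<open>\<Theta>\<close> relative to \<open>\<Gamma>\<close>, the context \<open>(\<Gamma>, \<Theta>)\<close> is \<open>\<Theta> @ \<Gamma>\<close>.\<close>

type_synonym 'f ctx = "'f expr list"

fun subst_ctx :: "(nat \<Rightarrow> 'f expr) \<Rightarrow> 'f ctx \<Rightarrow> 'f ctx" where
  "subst_ctx \<sigma> [] = []"
| "subst_ctx \<sigma> (A # \<Theta>) = subst (up (length \<Theta>) \<sigma>) A # subst_ctx \<sigma> \<Theta>"

datatype 'e assertion =
    IsType 'e                   \<comment> \<open>\<open>A \<in> Type\<close>\<close>
  | HasType 'e 'e               \<comment> \<open>\<open>a \<in> A\<close>\<close>
  | EqType 'e 'e                \<comment> \<open>\<open>A = B \<in> Type\<close>\<close>
  | EqTerm 'e 'e 'e             \<comment> \<open>\<open>a = b \<in> A\<close>\<close>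

type_synonym 'f judgement = "'f ctx \<times> 'f expr assertion"

text \<open>A type theory is given by its set \<open>T\<close> of derivable judgements.\<close>

fun is_ctx :: "'f judgement set \<Rightarrow> 'f ctx \<Rightarrow> bool" where
  "is_ctx T [] \<longleftrightarrow> True"
| "is_ctx T (A # \<Gamma>) \<longleftrightarrow> is_ctx T \<Gamma> \<and> (\<Gamma>, IsType A) \<in> T"

text \<open>\<open>is_mor T \<Phi> f \<Psi>\<close>: the tuple \<open>f\<close> is a context morphism from \<open>\<Phi>\<close> to \<open>\<Psi>\<close>.\<close>

fun is_mor :: "'f judgement set \<Rightarrow> 'f ctx \<Rightarrow> 'f expr list \<Rightarrow> 'f ctx \<Rightarrow> bool" where
  "is_mor T \<Phi> [] [] \<longleftrightarrow> is_ctx T \<Phi>"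
| "is_mor T \<Phi> (b # f) (B # \<Psi>) \<longleftrightarrow>
    is_mor T \<Phi> f \<Psi> \<and> (\<Psi>, IsType B) \<in> T \<and> (\<Phi>, HasType b (subst (tup f) B)) \<in> T"
| "is_mor T \<Phi> _ _ \<longleftrightarrow> False"

fun eq_ctx :: "'f judgement set \<Rightarrow> 'f ctx \<Rightarrow> 'f ctx \<Rightarrow> bool" where
  "eq_ctx T [] [] \<longleftrightarrow> True"
| "eq_ctx T (A # \<Gamma>) (B # \<Delta>) \<longleftrightarrow> eq_ctx T \<Gamma> \<Delta> \<and> (\<Gamma>, EqType A B) \<in> T"
| "eq_ctx T _ _ \<longleftrightarrow> False"

fun eq_mor :: "'f judgement set \<Rightarrow> 'f ctx \<Rightarrow> 'f expr list \<Rightarrow> 'f expr list \<Rightarrow> 'f ctx \<Rightarrow> bool" where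
  "eq_mor T \<Phi> [] [] [] \<longleftrightarrow> is_ctx T \<Phi>"
| "eq_mor T \<Phi> (b # f) (c # g) (B # \<Psi>) \<longleftrightarrow>
    eq_mor T \<Phi> f g \<Psi> \<and> (\<Psi>, IsType B) \<in> T \<and> (\<Phi>, EqTerm b c (subst (tup f) B)) \<in> T"
| "eq_mor T \<Phi> _ _ _ \<longleftrightarrow> False"


section \<open>Type theories\<close>

text \<open>\<open>T\<close> is closed under the structural rules; it may be closed under any further rules,
  such as those of other type formers or the compatibility of term formers with equality. The first
  group of assumptions says that derivable judgements are meaningful: they only mention declared
  variables and their presuppositions are derivable. Substitution is simultaneous; weakening is
  substitution along the context morphism of variables \<open>(\<Gamma>, \<Delta>) \<rightarrow> \<Gamma>\<close>, and substitution for a single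
  variable is substitution along \<open>\<Gamma> \<rightarrow> (\<Gamma>, x \<in> A)\<close>.\<close>

locale type_theory =
  fixes T :: "'f judgement set"
  assumes scope: "(\<Gamma>, X) \<in> T \<Longrightarrow> e \<in> set_assertion X \<Longrightarrow> scoped (length \<Gamma>) e"
    and pre_ctx: "(\<Gamma>, X) \<in> T \<Longrightarrow> is_ctx T \<Gamma>"
    and pre_HasType: "(\<Gamma>, HasType a A) \<in> T \<Longrightarrow> (\<Gamma>, IsType A) \<in> T"
    and pre_EqType: "(\<Gamma>, EqType A B) \<in> T \<Longrightarrow> (\<Gamma>, IsType A) \<in> T \<and> (\<Gamma>, IsType B) \<in> T"
    and pre_EqTerm: "(\<Gamma>, EqTerm a b A) \<in> T \<Longrightarrow> (\<Gamma>, HasType a A) \<in> T \<and> (\<Gamma>, HasType b A) \<in> T"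
    and var: "is_ctx T \<Gamma> \<Longrightarrow> i < length \<Gamma> \<Longrightarrow> (\<Gamma>, HasType (Var i) (weaken (Suc i) (\<Gamma> ! i))) \<in> T"
    and substitution: "(\<Psi>, X) \<in> T \<Longrightarrow> is_mor T \<Phi> f \<Psi> \<Longrightarrow> (\<Phi>, map_assertion (subst (tup f)) X) \<in> T"
    and substitution_EqType: "(\<Psi>, IsType A) \<in> T \<Longrightarrow> eq_mor T \<Phi> f g \<Psi> \<Longrightarrow>
      (\<Phi>, EqType (subst (tup f) A) (subst (tup g) A)) \<in> T"
    and substitution_EqTerm: "(\<Psi>, HasType a A) \<in> T \<Longrightarrow> eq_mor T \<Phi> f g \<Psi> \<Longrightarrow>
      (\<Phi>, EqTerm (subst (tup f) a) (subst (tup g) a) (subst (tup f) A)) \<in> T"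
    and EqType_refl: "(\<Gamma>, IsType A) \<in> T \<Longrightarrow> (\<Gamma>, EqType A A) \<in> T"
    and EqType_sym: "(\<Gamma>, EqType A B) \<in> T \<Longrightarrow> (\<Gamma>, EqType B A) \<in> T"
    and EqType_trans: "(\<Gamma>, EqType A B) \<in> T \<Longrightarrow> (\<Gamma>, EqType B C) \<in> T \<Longrightarrow> (\<Gamma>, EqType A C) \<in> T"
    and EqTerm_refl: "(\<Gamma>, HasType a A) \<in> T \<Longrightarrow> (\<Gamma>, EqTerm a a A) \<in> T"
    and EqTerm_sym: "(\<Gamma>, EqTerm a b A) \<in> T \<Longrightarrow> (\<Gamma>, EqTerm b a A) \<in> T"
    and EqTerm_trans: "(\<Gamma>, EqTerm a b A) \<in> T \<Longrightarrow> (\<Gamma>, EqTerm b c A) \<in> T \<Longrightarrow> (\<Gamma>, EqTerm a c A) \<in> T"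
    and HasType_conv: "(\<Gamma>, HasType a A) \<in> T \<Longrightarrow> (\<Gamma>, EqType A B) \<in> T \<Longrightarrow> (\<Gamma>, HasType a B) \<in> T"
    and EqTerm_conv: "(\<Gamma>, EqTerm a b A) \<in> T \<Longrightarrow> (\<Gamma>, EqType A B) \<in> T \<Longrightarrow> (\<Gamma>, EqTerm a b B) \<in> T"

text \<open>Identity types. The term formers take all the data of their rules as arguments, including those
  usually suppressed: \<open>rf A a\<close> is \<open>r(a)\<close>, and \<open>J A \<Theta> C a b p d\<close> is \<open>J(a, b, p, d)\<close>, where \<open>\<Theta>\<close>, \<open>C\<close> and
  \<open>d\<close> bind \<open>(x, y, u)\<close>, \<open>(x, y, u, \<Theta>)\<close> and \<open>(x, \<Theta>(x, x, r(x)))\<close>, and the term itself is relative to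
  the ambient context extended by \<open>\<Theta>(a, b, p)\<close>. The formers need not be primitive symbols of
  the syntax; being stable under substitution is all that is required of them.\<close>

definition id_ctx ::
  "('f expr \<Rightarrow> 'f expr \<Rightarrow> 'f expr \<Rightarrow> 'f expr) \<Rightarrow> 'f expr \<Rightarrow> 'f ctx" where
  "id_ctx Idt A = [Idt (weaken 2 A) (Var 1) (Var 0), weaken 1 A, A]"
    \<comment> \<open>\<open>(x \<in> A, y \<in> A, u \<in> Id\<^sub>A(x, y))\<close>\<close>

definition at_path :: "'f expr \<Rightarrow> 'f expr \<Rightarrow> 'f expr \<Rightarrow> nat \<Rightarrow> 'f expr" where
  "at_path a b p = tup [p, b, a]"
    \<comment> \<open>\<open>x := a, y := b, u := p\<close>\<close>

definition on_diag :: "('f expr \<Rightarrow> 'f expr \<Rightarrow> 'f expr) \<Rightarrow> 'f expr \<Rightarrow> nat \<Rightarrow> 'f expr" where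
  "on_diag rf A = tup [rf (weaken 1 A) (Var 0), Var 0]"
    \<comment> \<open>\<open>y := x, u := r(x)\<close>, keeping \<open>x\<close>\<close>

locale identity_type_theory = type_theory T
  for T :: "'f judgement set" +
  fixes Idt :: "'f expr \<Rightarrow> 'f expr \<Rightarrow> 'f expr \<Rightarrow> 'f expr"
    and rf :: "'f expr \<Rightarrow> 'f expr \<Rightarrow> 'f expr"
    and J :: "'f expr \<Rightarrow> 'f ctx \<Rightarrow> 'f expr \<Rightarrow> 'f expr \<Rightarrow> 'f expr \<Rightarrow> 'f expr \<Rightarrow> 'f expr \<Rightarrow> 'f expr"
  assumes Id_subst: "subst \<sigma> (Idt A a b) = Idt (subst \<sigma> A) (subst \<sigma> a) (subst \<sigma> b)"
    and rf_subst: "subst \<sigma> (rf A a) = rf (subst \<sigma> A) (subst \<sigma> a)"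
    and J_subst: "subst (up (length \<Theta>) \<sigma>) (J A \<Theta> C a b p d) =
      J (subst \<sigma> A) (subst_ctx (up 3 \<sigma>) \<Theta>) (subst (up (length \<Theta> + 3) \<sigma>) C)
        (subst \<sigma> a) (subst \<sigma> b) (subst \<sigma> p) (subst (up (length \<Theta> + 1) \<sigma>) d)"
    and Id_form: "(\<Gamma>, IsType A) \<in> T \<Longrightarrow> (\<Gamma>, HasType a A) \<in> T \<Longrightarrow> (\<Gamma>, HasType b A) \<in> T \<Longrightarrow>
      (\<Gamma>, IsType (Idt A a b)) \<in> T"
    and Id_intro: "(\<Gamma>, HasType a A) \<in> T \<Longrightarrow> (\<Gamma>, HasType (rf A a) (Idt A a a)) \<in> T"
    and Id_elim:
      "(\<Gamma>, HasType a A) \<in> T \<Longrightarrow> (\<Gamma>, HasType b A) \<in> T \<Longrightarrow> (\<Gamma>, HasType p (Idt A a b)) \<in> T \<Longrightarrow>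
       is_ctx T (\<Theta> @ id_ctx Idt A @ \<Gamma>) \<Longrightarrow>
       (\<Theta> @ id_ctx Idt A @ \<Gamma>, IsType C) \<in> T \<Longrightarrow>
       (subst_ctx (on_diag rf A) \<Theta> @ A # \<Gamma>, HasType d (subst (up (length \<Theta>) (on_diag rf A)) C)) \<in> T \<Longrightarrow>
       (subst_ctx (at_path a b p) \<Theta> @ \<Gamma>,
         HasType (J A \<Theta> C a b p d) (subst (up (length \<Theta>) (at_path a b p)) C)) \<in> T"
    and Id_comp:
      "(\<Gamma>, HasType a A) \<in> T \<Longrightarrow>
       is_ctx T (\<Theta> @ id_ctx Idt A @ \<Gamma>) \<Longrightarrow>
       (\<Theta> @ id_ctx Idt A @ \<Gamma>, IsType C) \<in> T \<Longrightarrow>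
       (subst_ctx (on_diag rf A) \<Theta> @ A # \<Gamma>, HasType d (subst (up (length \<Theta>) (on_diag rf A)) C)) \<in> T \<Longrightarrow>
       (subst_ctx (at_path a a (rf A a)) \<Theta> @ \<Gamma>,
         EqTerm (J A \<Theta> C a a (rf A a) d) (subst (up (length \<Theta>) (tup [a])) d)
           (subst (up (length \<Theta>) (at_path a a (rf A a))) C)) \<in> T"


section \<open>The classifying category\<close>

definition ctx_rel :: "'f judgement set \<Rightarrow> ('f ctx \<times> 'f ctx) set" where
  "ctx_rel T = {(\<Gamma>, \<Delta>). is_ctx T \<Gamma> \<and> is_ctx T \<Delta> \<and> eq_ctx T \<Gamma> \<Delta>}"

type_synonym 'f mor = "'f ctx \<times> 'f expr list \<times> 'f ctx"

definition mors :: "'f judgement set \<Rightarrow> 'f mor set" where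
  "mors T = {(\<Phi>, f, \<Psi>). is_mor T \<Phi> f \<Psi>}"

definition mor_rel :: "'f judgement set \<Rightarrow> ('f mor \<times> 'f mor) set" where
  "mor_rel T = {((\<Phi>, f, \<Psi>), (\<Phi>', f', \<Psi>')).
     (\<Phi>, f, \<Psi>) \<in> mors T \<and> (\<Phi>', f', \<Psi>') \<in> mors T \<and>
     eq_ctx T \<Phi> \<Phi>' \<and> eq_ctx T \<Psi> \<Psi>' \<and> eq_mor T \<Phi> f f' \<Psi>}"

definition ctx_class :: "'f judgement set \<Rightarrow> 'f ctx \<Rightarrow> 'f ctx set" where
  "ctx_class T \<Gamma> = ctx_rel T `` {\<Gamma>}"

definition mor_class :: "'f judgement set \<Rightarrow> 'f ctx \<Rightarrow> 'f expr list \<Rightarrow> 'f ctx \<Rightarrow> 'f mor set" where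
  "mor_class T \<Phi> f \<Psi> = mor_rel T `` {(\<Phi>, f, \<Psi>)}"

text \<open>The operations on equivalence classes are unions over all (composable) representatives.\<close>

definition classifying_category :: "'f judgement set \<Rightarrow> ('f ctx set, 'f mor set) cat" where
  "classifying_category T =
    \<lparr> ob = {\<Gamma>. is_ctx T \<Gamma>} // ctx_rel T,
      ar = mors T // mor_rel T,
      src = (\<lambda>F. \<Union>(\<Phi>, f, \<Psi>) \<in> F. ctx_class T \<Phi>),
      tgt = (\<lambda>F. \<Union>(\<Phi>, f, \<Psi>) \<in> F. ctx_class T \<Psi>),
      ident = (\<lambda>X. \<Union>\<Gamma> \<in> X. mor_class T \<Gamma> (map Var [0..<length \<Gamma>]) \<Gamma>),
      cmp = (\<lambda>G F. \<Union>{mor_class T \<Phi> (map (subst (tup f)) g) \<Xi> | \<Phi> f \<Psi> g \<Xi>.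
                       (\<Phi>, f, \<Psi>) \<in> F \<and> (\<Psi>, g, \<Xi>) \<in> G}) \<rparr>"

definition display_maps :: "'f judgement set \<Rightarrow> 'f mor set set" where
  "display_maps T =
    {mor_class T (A # \<Gamma>) (map Var [1..<Suc (length \<Gamma>)]) \<Gamma> | \<Gamma> A. (\<Gamma>, IsType A) \<in> T}"

end

theory Submission
  imports Defs
begin

text \<open>No identity types of contexts are needed. To factorise \<open>f : \<Phi> \<rightarrow> (\<Psi>, y \<in> B)\<close>, first factorise its
  projection to \<open>\<Psi>\<close> as \<open>p i\<close> with \<open>i : \<Phi> \<rightarrow> E\<close>. Since \<open>i\<close> lifts against display maps, the last component
  of \<open>f\<close> extends along \<open>i\<close> to a term \<open>b \<in> B(p)\<close> over \<open>E\<close>, and \<open>f\<close> factors through the context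
  \<open>(E, y \<in> B(p), u \<in> Id(b, y))\<close>. What remains is that \<open>E \<rightarrow> (E, y \<in> B(p), u \<in> Id(b, y))\<close> lifts against
  display maps, which is path induction with one endpoint fixed; it is derived from the
  elimination rule, where the dependent context \<open>\<Theta>\<close> replaces the use of function types.\<close>


section \<open>Calculus of substitutions\<close>

text \<open>The eliminator has both endpoints variable, whereas \<open>b\<close> is a term over
  \<Gamma> and C speaks of paths from it; C cannot be read over a variable left endpoint. So the
  data that depend on \<open>b\<close>, a path w from \<open>b\<close> to x and an element of C over
  it, are put into \<Theta>. Eliminating u then lands over the composite of u and w. A composition
  defined by eliminating u is strictly unital only for u = r(x), so with w = r(b) one arrives over a
  path that is merely identified with u; this costs a second elimination, one dimension up.
  Diagonals must make triangles of arrows commute, which is definitional equality, so at u = r(b)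
  the composite, the unit path and both transports all have to reduce strictly. A further obstacle
  is that compatibility of \<open>J\<close> and \<open>Idt\<close> with definitional equality is not
  among the axioms. \<open>J\<close> enters only through \<open>J_generic\<close>, as one term over
  variables; other instances arise from it by substitution, which does respect equality.\<close>

definition wk :: "nat \<Rightarrow> nat \<Rightarrow> 'f expr" where
  "wk k i = Var (i + k)"

text \<open>With \<open>wk\<close> this gives the normal form of explicit substitution calculi:
  concrete substitutions below are finite sequences of terms followed by some \<open>wk k\<close> or
  by a given \<sigma>. Simplification to this form decides the syntactic equalities of types that
  reindexing produces.\<close>

definition scons :: "'f expr \<Rightarrow> (nat \<Rightarrow> 'f expr) \<Rightarrow> nat \<Rightarrow> 'f expr" (infixr \<open>\<cdot>\<close> 65) where
  "(a \<cdot> \<sigma>) i = (case i of 0 \<Rightarrow> a | Suc j \<Rightarrow> \<sigma> j)"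

text \<open>A name for the composite \<open>subst \<sigma> \<circ> wk k\<close> (see
  \<open>subst_comp_wk\<close>), so that simplification can evaluate it by discarding the leading
  terms of a sequence.\<close>

definition sdrop :: "nat \<Rightarrow> (nat \<Rightarrow> 'f expr) \<Rightarrow> nat \<Rightarrow> 'f expr" where
  "sdrop k \<sigma> i = \<sigma> (i + k)"

text \<open>Going under a binder weakens the substituted terms by a renaming. The composition law
  \<open>subst_subst\<close> therefore presupposes the laws for a renaming before and after a
  substitution, which in turn rest on the one for two renamings.\<close>

lemma up_ren_comp: "up_ren k \<rho> \<circ> up_ren k \<rho>' = up_ren k (\<rho> \<circ> \<rho>')"
  by (auto simp: up_ren_def fun_eq_iff)

lemma rename_rename: "rename \<rho> (rename \<rho>' e) = rename (\<rho> \<circ> \<rho>') e"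
  by (induction e arbitrary: \<rho> \<rho>') (auto simp: up_ren_comp)

lemma rename_weaken: "rename (up_ren k \<rho>) (weaken k e) = weaken k (rename \<rho> e)"
  by (auto simp: weaken_def rename_rename up_ren_def intro!: arg_cong2[where f = rename])

lemma up_comp_up_ren: "up k \<sigma> \<circ> up_ren k \<rho> = up k (\<sigma> \<circ> \<rho>)"
  by (auto simp: up_ren_def up_def fun_eq_iff)

lemma subst_rename: "subst \<sigma> (rename \<rho> e) = subst (\<sigma> \<circ> \<rho>) e"
  by (induction e arbitrary: \<sigma> \<rho>) (auto simp: up_comp_up_ren)

lemma rename_comp_up: "rename (up_ren k \<rho>) \<circ> up k \<sigma> = up k (rename \<rho> \<circ> \<sigma>)"
  by (auto simp: up_def fun_eq_iff rename_weaken up_ren_def)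

lemma rename_subst: "rename \<rho> (subst \<sigma> e) = subst (rename \<rho> \<circ> \<sigma>) e"
  by (induction e arbitrary: \<sigma> \<rho>) (auto simp: rename_comp_up)

lemma subst_up_weaken: "subst (up k \<sigma>) (weaken k e) = weaken k (subst \<sigma> e)"
  by (auto simp: weaken_def subst_rename rename_subst up_def fun_eq_iff
      intro!: arg_cong2[where f = subst])

lemma subst_comp_up: "subst (up k \<sigma>) \<circ> up k \<tau> = up k (subst \<sigma> \<circ> \<tau>)"
  by (auto simp: up_def fun_eq_iff subst_up_weaken)

lemma subst_subst: "subst \<sigma> (subst \<tau> e) = subst (subst \<sigma> \<circ> \<tau>) e"
  by (induction e arbitrary: \<sigma> \<tau>) (auto simp: subst_comp_up)

lemma up_Var: "up k Var = Var"
  by (auto simp: up_def weaken_def fun_eq_iff)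

lemma subst_Var [simp]: "subst Var e = e"
proof (induction e)
  case (Op f es)
  then have "map (\<lambda>(k, e). (k, subst Var e)) es = es"
    by (intro map_idI) auto
  then show ?case by (simp add: up_Var)
qed simp

lemma subst_Var_comp [simp]: "subst Var \<circ> \<sigma> = \<sigma>"
  by auto

lemma subst_comp_Var [simp]: "subst \<sigma> \<circ> Var = \<sigma>"
  by auto

lemma subst_cong: "scoped n e \<Longrightarrow> (\<And>i. i < n \<Longrightarrow> \<sigma> i = \<tau> i) \<Longrightarrow> subst \<sigma> e = subst \<tau> e"
proof (induction e arbitrary: n \<sigma> \<tau>)
  case (Op f es)
  have "subst (up k \<sigma>) e = subst (up k \<tau>) e" if "(k, e) \<in> set es" for k e
    using Op.prems that by (intro Op.IH[of "(k, e)" e "n + k"]) (auto simp: up_def)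
  then show ?case by auto
qed simp

lemma weaken_subst: "weaken k e = subst (wk k) e"
proof -
  have "rename \<rho> e = subst (Var \<circ> \<rho>) e" for \<rho> :: "nat \<Rightarrow> nat"
    using rename_subst[of \<rho> Var e] by (simp add: comp_def)
  then have "weaken k e = subst (Var \<circ> (\<lambda>i. i + k)) e"
    by (simp only: weaken_def)
  also have "Var \<circ> (\<lambda>i. i + k) = wk k"
    by (auto simp: wk_def)
  finally show ?thesis .
qed

lemma wk_0 [simp]: "wk 0 = Var"
  by (auto simp: wk_def)

lemma scons_0 [simp]: "(a \<cdot> \<sigma>) 0 = a"
  and scons_Suc [simp]: "(a \<cdot> \<sigma>) (Suc i) = \<sigma> i"
  and scons_numeral [simp]: "(a \<cdot> \<sigma>) (numeral n) = \<sigma> (pred_numeral n)"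
  by (auto simp: scons_def numeral_eq_Suc)

lemma scons_comp_Suc [simp]: "(a \<cdot> \<sigma>) \<circ> Suc = \<sigma>"
  by auto

lemma scons_eta: "\<sigma> = \<sigma> 0 \<cdot> (\<sigma> \<circ> Suc)"
  by (auto simp: fun_eq_iff scons_def split: nat.splits)

lemma wk_app [simp]: "wk k i = Var (i + k)"
  by (simp add: wk_def)

lemma Var_comp_Suc [simp]: "Var \<circ> Suc = wk (Suc 0)"
  by auto

lemma scons_wk [simp]: "n = Suc k \<Longrightarrow> Var k \<cdot> wk n = wk k"
  by (auto simp: fun_eq_iff scons_def split: nat.splits)

lemma subst_comp_scons [simp]: "subst \<sigma> \<circ> (a \<cdot> \<tau>) = subst \<sigma> a \<cdot> (subst \<sigma> \<circ> \<tau>)"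
  by (auto simp: fun_eq_iff scons_def split: nat.splits)

lemma subst_comp_wk [simp]: "subst \<sigma> \<circ> wk k = sdrop k \<sigma>"
  by (auto simp: fun_eq_iff sdrop_def)

lemma sdrop_0 [simp]: "sdrop 0 \<sigma> = \<sigma>"
  and sdrop_scons_Suc [simp]: "sdrop (Suc k) (a \<cdot> \<sigma>) = sdrop k \<sigma>"
  and sdrop_scons_numeral [simp]: "sdrop (numeral n) (a \<cdot> \<sigma>) = sdrop (pred_numeral n) \<sigma>"
  and sdrop_wk [simp]: "sdrop k (wk l) = wk (k + l)"
  and sdrop_Var [simp]: "sdrop k Var = wk k"
  by (auto simp: fun_eq_iff sdrop_def scons_def add_ac numeral_eq_Suc)

lemma subst_comp_assoc: "subst \<sigma> \<circ> (subst \<tau> \<circ> \<rho>) = subst (subst \<sigma> \<circ> \<tau>) \<circ> \<rho>"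
  by (auto simp: fun_eq_iff subst_subst)

lemma up_0 [simp]: "up 0 \<sigma> = \<sigma>"
  by (auto simp: up_def weaken_subst)

lemma up_Suc: "up (Suc k) \<sigma> = Var 0 \<cdot> (subst (wk (Suc 0)) \<circ> up k \<sigma>)"
  by (auto simp: fun_eq_iff up_def scons_def weaken_subst subst_subst comp_def split: nat.splits
      intro!: arg_cong2[where f = subst])

lemma up_up: "up m (up n \<sigma>) = up (m + n) \<sigma>"
proof (induction m)
  case (Suc m)
  then show ?case by (simp add: up_Suc)
qed simp

lemma subst_ctx_append: "subst_ctx \<sigma> (\<Theta> @ \<Xi>) = subst_ctx (up (length \<Xi>) \<sigma>) \<Theta> @ subst_ctx \<sigma> \<Xi>"
  by (induction \<Theta>) (simp_all add: up_up)

lemma tup_Nil [simp]: "tup [] = Var"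
  and tup_Cons [simp]: "tup (a # f) = a \<cdot> tup f"
  by (auto simp: fun_eq_iff tup_def scons_def split: nat.splits)

lemma map_tup [simp]: "map (tup f) [0..<length f] = f"
  by (auto simp: tup_def intro: nth_equalityI)

lemma tup_map: "i < n \<Longrightarrow> tup (map \<sigma> [0..<n]) i = \<sigma> i"
  by (simp add: tup_def)

lemma map_upt_Suc: "map \<sigma> [0..<Suc n] = \<sigma> 0 # map (\<sigma> \<circ> Suc) [0..<n]"
  by (simp add: upt_conv_Cons map_Suc_upt[symmetric] del: upt_Suc)

lemma length_subst_ctx [simp]: "length (subst_ctx \<sigma> \<Theta>) = length \<Theta>"
  by (induction \<Theta>) auto

lemma subst_ctx_subst_ctx: "subst_ctx \<sigma> (subst_ctx \<tau> \<Theta>) = subst_ctx (subst \<sigma> \<circ> \<tau>) \<Theta>"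
  by (induction \<Theta>) (simp_all only: subst_ctx.simps subst_subst subst_comp_up length_subst_ctx)

lemma subst_ctx_Var [simp]: "subst_ctx Var \<Theta> = \<Theta>"
  by (induction \<Theta>) (auto simp: up_Var)


lemma comp_nat [simp]: "(f \<circ> g) (0 :: nat) = f (g 0)" "(f \<circ> g) (Suc i) = f (g (Suc i))"
    "(f \<circ> g) (numeral n :: nat) = f (g (numeral n))"
  by auto

text \<open>Eta-contracted, \<open>comp_apply\<close> would unfold every \<open>subst \<sigma> \<circ> \<tau>\<close> in rewrite rules and premises.\<close>

declare comp_apply [simp del]


section \<open>Judgements under substitutions\<close>

context type_theory
begin

abbreviation ty where "ty \<Gamma> A \<equiv> (\<Gamma>, IsType A) \<in> T"
abbreviation tm where "tm \<Gamma> a A \<equiv> (\<Gamma>, HasType a A) \<in> T"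
abbreviation eqty where "eqty \<Gamma> A B \<equiv> (\<Gamma>, EqType A B) \<in> T"
abbreviation eqtm where "eqtm \<Gamma> a b A \<equiv> (\<Gamma>, EqTerm a b A) \<in> T"

text \<open>Context morphisms presented by total functions: composition is
  \<open>subst \<sigma> \<circ> \<tau>\<close> and the identity is \<open>Var\<close>, with no
  bookkeeping of lengths. Values beyond the declared variables are arbitrary; they are never read,
  since derivable judgements are well scoped.\<close>

definition sub :: "'f ctx \<Rightarrow> (nat \<Rightarrow> 'f expr) \<Rightarrow> 'f ctx \<Rightarrow> bool" where
  "sub \<Phi> \<sigma> \<Psi> \<longleftrightarrow> is_mor T \<Phi> (map \<sigma> [0..<length \<Psi>]) \<Psi>"

definition eqsub :: "'f ctx \<Rightarrow> (nat \<Rightarrow> 'f expr) \<Rightarrow> (nat \<Rightarrow> 'f expr) \<Rightarrow> 'f ctx \<Rightarrow> bool" where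
  "eqsub \<Phi> \<sigma> \<tau> \<Psi> \<longleftrightarrow> eq_mor T \<Phi> (map \<sigma> [0..<length \<Psi>]) (map \<tau> [0..<length \<Psi>]) \<Psi>"

lemma ty_ctx: "ty \<Gamma> A \<Longrightarrow> is_ctx T \<Gamma>"
  and tm_ctx: "tm \<Gamma> a A \<Longrightarrow> is_ctx T \<Gamma>"
  by (auto dest: pre_ctx)

lemma ty_scope: "ty \<Gamma> A \<Longrightarrow> scoped (length \<Gamma>) A"
  by (auto dest: scope)

lemma ty_subst_cong:
  "ty \<Gamma> A \<Longrightarrow> (\<And>i. i < length \<Gamma> \<Longrightarrow> \<sigma> i = \<tau> i) \<Longrightarrow> subst \<sigma> A = subst \<tau> A"
  by (blast intro: subst_cong ty_scope)

lemma sub_Nil [simp]: "sub \<Phi> \<sigma> [] \<longleftrightarrow> is_ctx T \<Phi>"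
  by (simp add: sub_def)

lemma sub_Cons: "sub \<Phi> \<sigma> (A # \<Psi>) \<longleftrightarrow>
    sub \<Phi> (\<sigma> \<circ> Suc) \<Psi> \<and> ty \<Psi> A \<and> tm \<Phi> (\<sigma> 0) (subst (\<sigma> \<circ> Suc) A)"
proof -
  have "subst (tup (map (\<sigma> \<circ> Suc) [0..<length \<Psi>])) A = subst (\<sigma> \<circ> Suc) A" if "ty \<Psi> A"
    using that by (rule ty_subst_cong) (simp add: tup_map)
  then show ?thesis
    by (auto simp: sub_def map_upt_Suc simp del: upt_Suc)
qed

lemma eqsub_Nil [simp]: "eqsub \<Phi> \<sigma> \<tau> [] \<longleftrightarrow> is_ctx T \<Phi>"
  by (simp add: eqsub_def)

lemma eqsub_Cons: "eqsub \<Phi> \<sigma> \<tau> (A # \<Psi>) \<longleftrightarrow>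
    eqsub \<Phi> (\<sigma> \<circ> Suc) (\<tau> \<circ> Suc) \<Psi> \<and> ty \<Psi> A \<and> eqtm \<Phi> (\<sigma> 0) (\<tau> 0) (subst (\<sigma> \<circ> Suc) A)"
proof -
  have "subst (tup (map (\<sigma> \<circ> Suc) [0..<length \<Psi>])) A = subst (\<sigma> \<circ> Suc) A" if "ty \<Psi> A"
    using that by (rule ty_subst_cong) (simp add: tup_map)
  then show ?thesis
    by (auto simp: eqsub_def map_upt_Suc simp del: upt_Suc)
qed

lemma is_mor_length: "is_mor T \<Phi> f \<Psi> \<Longrightarrow> length f = length \<Psi>"
  by (induction T \<Phi> f \<Psi> rule: is_mor.induct) auto

lemma eq_mor_length: "eq_mor T \<Phi> f g \<Psi> \<Longrightarrow> length f = length \<Psi> \<and> length g = length \<Psi>"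
  by (induction T \<Phi> f g \<Psi> rule: eq_mor.induct) auto

lemma is_mor_iff_sub: "is_mor T \<Phi> f \<Psi> \<longleftrightarrow> length f = length \<Psi> \<and> sub \<Phi> (tup f) \<Psi>"
  by (metis is_mor_length map_tup sub_def)

lemma eq_mor_iff_eqsub:
  "eq_mor T \<Phi> f g \<Psi> \<longleftrightarrow>
    length f = length \<Psi> \<and> length g = length \<Psi> \<and> eqsub \<Phi> (tup f) (tup g) \<Psi>"
  by (metis eq_mor_length map_tup eqsub_def)

lemma sub_judgement:
  assumes "(\<Psi>, X) \<in> T" "sub \<Phi> \<sigma> \<Psi>"
  shows "(\<Phi>, map_assertion (subst \<sigma>) X) \<in> T"
proof -
  have "map_assertion (subst (tup (map \<sigma> [0..<length \<Psi>]))) X = map_assertion (subst \<sigma>) X"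
    using scope[OF assms(1)]
    by (intro assertion.map_cong0 subst_cong) (auto simp: tup_map)
  then show ?thesis
    using substitution[OF assms(1) assms(2)[unfolded sub_def]] by simp
qed

lemma sub_ty: "ty \<Psi> A \<Longrightarrow> sub \<Phi> \<sigma> \<Psi> \<Longrightarrow> ty \<Phi> (subst \<sigma> A)"
  and sub_tm: "tm \<Psi> a A \<Longrightarrow> sub \<Phi> \<sigma> \<Psi> \<Longrightarrow> tm \<Phi> (subst \<sigma> a) (subst \<sigma> A)"
  and sub_eqty: "eqty \<Psi> A B \<Longrightarrow> sub \<Phi> \<sigma> \<Psi> \<Longrightarrow> eqty \<Phi> (subst \<sigma> A) (subst \<sigma> B)"
  and sub_eqtm: "eqtm \<Psi> a b A \<Longrightarrow> sub \<Phi> \<sigma> \<Psi> \<Longrightarrow>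
    eqtm \<Phi> (subst \<sigma> a) (subst \<sigma> b) (subst \<sigma> A)"
  by (drule (1) sub_judgement; simp)+

lemma eqsub_ty:
  assumes "ty \<Psi> A" "eqsub \<Phi> \<sigma> \<tau> \<Psi>"
  shows "eqty \<Phi> (subst \<sigma> A) (subst \<tau> A)"
proof -
  have "subst (tup (map \<rho> [0..<length \<Psi>])) A = subst \<rho> A" for \<rho>
    using assms(1) by (rule ty_subst_cong) (simp add: tup_map)
  then show ?thesis
    using substitution_EqType[OF assms(1) assms(2)[unfolded eqsub_def]] by simp
qed

lemma eqsub_tm:
  assumes "tm \<Psi> a A" "eqsub \<Phi> \<sigma> \<tau> \<Psi>"
  shows "eqtm \<Phi> (subst \<sigma> a) (subst \<tau> a) (subst \<sigma> A)"
proof -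
  have "subst (tup (map \<rho> [0..<length \<Psi>])) e = subst \<rho> e"
    if "scoped (length \<Psi>) e" for \<rho> e
    using that by (rule subst_cong) (simp add: tup_map)
  then show ?thesis
    using substitution_EqTerm[OF assms(1) assms(2)[unfolded eqsub_def]] scope[OF assms(1)]
    by (metis assertion.set_intros(2,3))
qed

lemma sub_ctx_left: "sub \<Phi> \<sigma> \<Psi> \<Longrightarrow> is_ctx T \<Phi>"
  by (induction \<Psi> arbitrary: \<sigma>) (auto simp: sub_Cons)

lemma sub_ctx_right: "sub \<Phi> \<sigma> \<Psi> \<Longrightarrow> is_ctx T \<Psi>"
  by (induction \<Psi> arbitrary: \<sigma>) (auto simp: sub_Cons)

lemma subst_comp_Suc: "(subst \<sigma> \<circ> \<tau>) \<circ> Suc = subst \<sigma> \<circ> (\<tau> \<circ> Suc)"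
  by (fact comp_assoc)

lemma sub_comp: "sub \<Phi> \<sigma> \<Psi> \<Longrightarrow> sub \<Psi> \<tau> \<Xi> \<Longrightarrow> sub \<Phi> (subst \<sigma> \<circ> \<tau>) \<Xi>"
proof (induction \<Xi> arbitrary: \<tau>)
  case Nil
  then show ?case by (simp add: sub_ctx_left)
next
  case (Cons A \<Xi>)
  then show ?case
    by (simp only: sub_Cons subst_comp_Suc comp_nat subst_subst[symmetric]) (blast intro: sub_tm)
qed

text \<open>The recursive description would need weakening to show that \<open>Var\<close> is a
  morphism, and weakening is itself substitution along a morphism of variables. In the pointwise
  form both are immediate from the variable rule, which types every index at once.\<close>

lemma sub_iff_pointwise:
  "sub \<Phi> \<sigma> \<Psi> \<longleftrightarrow> is_ctx T \<Phi> \<and> is_ctx T \<Psi> \<and>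
    (\<forall>i < length \<Psi>. tm \<Phi> (\<sigma> i) (subst \<sigma> (weaken (Suc i) (\<Psi> ! i))))"
proof (induction \<Psi> arbitrary: \<sigma>)
  case (Cons A \<Psi>)
  have "sdrop (Suc (Suc i)) \<sigma> = sdrop (Suc i) (\<sigma> \<circ> Suc)" for i
    by (auto simp: sdrop_def comp_apply)
  moreover have "sdrop (Suc 0) \<sigma> = \<sigma> \<circ> Suc"
    by (auto simp: sdrop_def comp_apply)
  moreover have "\<sigma> (Suc i) = (\<sigma> \<circ> Suc) i" for i
    by (simp add: comp_apply)
  ultimately show ?case
    by (auto simp: sub_Cons Cons All_less_Suc2 weaken_subst subst_subst simp del: comp_nat)
qed simp

lemma sub_Var: "is_ctx T \<Gamma> \<Longrightarrow> sub \<Gamma> Var \<Gamma>"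
  by (auto simp: sub_iff_pointwise intro: var)

lemma sub_wk_append: "is_ctx T (\<Delta> @ \<Gamma>) \<Longrightarrow> sub (\<Delta> @ \<Gamma>) (wk (length \<Delta>)) \<Gamma>"
proof -
  assume ctx: "is_ctx T (\<Delta> @ \<Gamma>)"
  then have "is_ctx T \<Gamma>"
    by (induction \<Delta>) auto
  moreover have "tm (\<Delta> @ \<Gamma>) (Var (i + length \<Delta>)) (subst (wk (length \<Delta>)) (weaken (Suc i) (\<Gamma> ! i)))"
    if "i < length \<Gamma>" for i
    using var[OF ctx, of "i + length \<Delta>"] that
    by (simp add: nth_append weaken_subst subst_subst add_ac)
  ultimately show ?thesis
    using ctx by (auto simp: sub_iff_pointwise)
qed

lemma sub_wk_1: "ty \<Gamma> A \<Longrightarrow> sub (A # \<Gamma>) (wk (Suc 0)) \<Gamma>"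
  using sub_wk_append[of "[A]" \<Gamma>] by (auto dest: ty_ctx)

lemma sub_scons: "sub \<Phi> \<sigma> \<Psi> \<Longrightarrow> ty \<Psi> A \<Longrightarrow> tm \<Phi> a (subst \<sigma> A) \<Longrightarrow> sub \<Phi> (a \<cdot> \<sigma>) (A # \<Psi>)"
  by (simp add: sub_Cons)

lemma eqsub_scons:
  "eqsub \<Phi> \<sigma> \<tau> \<Psi> \<Longrightarrow> ty \<Psi> A \<Longrightarrow> eqtm \<Phi> a b (subst \<sigma> A) \<Longrightarrow> eqsub \<Phi> (a \<cdot> \<sigma>) (b \<cdot> \<tau>) (A # \<Psi>)"
  by (simp add: eqsub_Cons)

lemma sub_lift:
  assumes "sub \<Phi> \<sigma> \<Psi>" "ty \<Psi> A"
  shows "sub (subst \<sigma> A # \<Phi>) (Var 0 \<cdot> (subst (wk (Suc 0)) \<circ> \<sigma>)) (A # \<Psi>)"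
proof (rule sub_scons)
  have ty: "ty \<Phi> (subst \<sigma> A)"
    using assms by (blast intro: sub_ty)
  then show "sub (subst \<sigma> A # \<Phi>) (subst (wk (Suc 0)) \<circ> \<sigma>) \<Psi>"
    by (blast intro: sub_comp sub_wk_1 assms)
  show "tm (subst \<sigma> A # \<Phi>) (Var 0) (subst (subst (wk (Suc 0)) \<circ> \<sigma>) A)"
    using var[of "subst \<sigma> A # \<Phi>" 0] ty ty_ctx[OF ty] by (simp add: weaken_subst subst_subst)
qed fact

section \<open>Definitional equality of context morphisms\<close>

lemma eqsub_refl: "sub \<Phi> \<sigma> \<Psi> \<Longrightarrow> eqsub \<Phi> \<sigma> \<sigma> \<Psi>"
  by (induction \<Psi> arbitrary: \<sigma>) (auto simp: sub_Cons eqsub_Cons intro: EqTerm_refl)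

lemma eqsub_left: "eqsub \<Phi> \<sigma> \<tau> \<Psi> \<Longrightarrow> sub \<Phi> \<sigma> \<Psi>"
  by (induction \<Psi> arbitrary: \<sigma> \<tau>) (auto simp: sub_Cons eqsub_Cons dest: pre_EqTerm)

text \<open>The last components are compared in the type reindexed along the left morphism, so
  exchanging the sides requires conversion to the type reindexed along the right one. Transitivity
  needs the same conversion.\<close>

lemma eqsub_sym: "eqsub \<Phi> \<sigma> \<tau> \<Psi> \<Longrightarrow> eqsub \<Phi> \<tau> \<sigma> \<Psi>"
  by (induction \<Psi> arbitrary: \<sigma> \<tau>)
    (auto simp: eqsub_Cons intro: EqTerm_conv[OF EqTerm_sym] eqsub_ty)

lemma eqsub_right: "eqsub \<Phi> \<sigma> \<tau> \<Psi> \<Longrightarrow> sub \<Phi> \<tau> \<Psi>"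
  by (blast intro: eqsub_left eqsub_sym)

lemma eqsub_trans: "eqsub \<Phi> \<sigma> \<tau> \<Psi> \<Longrightarrow> eqsub \<Phi> \<tau> \<rho> \<Psi> \<Longrightarrow> eqsub \<Phi> \<sigma> \<rho> \<Psi>"
proof (induction \<Psi> arbitrary: \<sigma> \<tau> \<rho>)
  case (Cons A \<Psi>)
  then have "eqty \<Phi> (subst (\<tau> \<circ> Suc) A) (subst (\<sigma> \<circ> Suc) A)"
    by (auto simp: eqsub_Cons intro: eqsub_ty eqsub_sym)
  with Cons show ?case
    by (auto simp: eqsub_Cons intro: EqTerm_trans EqTerm_conv)
qed simp

lemma eqsub_comp_right: "eqsub \<Phi> \<sigma> \<tau> \<Psi> \<Longrightarrow> sub \<Psi> \<rho> \<Xi> \<Longrightarrow> eqsub \<Phi> (subst \<sigma> \<circ> \<rho>) (subst \<tau> \<circ> \<rho>) \<Xi>"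
proof (induction \<Xi> arbitrary: \<rho>)
  case Nil
  then show ?case by (auto dest: eqsub_left sub_ctx_left)
next
  case (Cons A \<Xi>)
  then show ?case
    by (simp only: sub_Cons eqsub_Cons subst_comp_Suc comp_nat subst_subst[symmetric])
      (blast intro: eqsub_tm)
qed

lemma eqsub_comp_left: "eqsub \<Psi> \<sigma> \<tau> \<Xi> \<Longrightarrow> sub \<Phi> \<rho> \<Psi> \<Longrightarrow> eqsub \<Phi> (subst \<rho> \<circ> \<sigma>) (subst \<rho> \<circ> \<tau>) \<Xi>"
proof (induction \<Xi> arbitrary: \<sigma> \<tau>)
  case Nil
  then show ?case by (auto dest: sub_ctx_left)
next
  case (Cons A \<Xi>)
  then show ?case
    by (simp only: eqsub_Cons subst_comp_Suc comp_nat subst_subst[symmetric])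
      (blast intro: sub_eqtm)
qed

text \<open>Changing one factor at a time; this makes composition of arrows independent of
  representatives.\<close>

lemma eqsub_comp:
  "eqsub \<Phi> \<sigma> \<sigma>' \<Psi> \<Longrightarrow> eqsub \<Psi> \<tau> \<tau>' \<Xi> \<Longrightarrow> eqsub \<Phi> (subst \<sigma> \<circ> \<tau>) (subst \<sigma>' \<circ> \<tau>') \<Xi>"
  by (blast intro: eqsub_trans eqsub_comp_right eqsub_comp_left eqsub_left eqsub_right)

section \<open>Definitional equality of contexts\<close>

lemma eq_ctx_refl: "is_ctx T \<Gamma> \<Longrightarrow> eq_ctx T \<Gamma> \<Gamma>"
  by (induction \<Gamma>) (auto intro: EqType_refl)

text \<open>Equal contexts are related by the identity substitution, so that transporting a judgement
  between them is an instance of substitution.\<close>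

lemma eq_ctx_sub: "eq_ctx T \<Gamma> \<Delta> \<Longrightarrow> is_ctx T \<Gamma> \<Longrightarrow> is_ctx T \<Delta> \<Longrightarrow> sub \<Gamma> Var \<Delta>"
proof (induction \<Gamma> arbitrary: \<Delta>)
  case Nil
  then show ?case by (cases \<Delta>) auto
next
  case (Cons A \<Gamma>)
  then obtain B \<Delta>' where \<Delta>: "\<Delta> = B # \<Delta>'"
    by (cases \<Delta>) auto
  have ty: "ty \<Gamma> A" and eq: "eqty \<Gamma> A B" and sub: "sub \<Gamma> Var \<Delta>'"
    using Cons \<Delta> by auto
  have "sub (A # \<Gamma>) (wk (Suc 0)) \<Delta>'"
    using sub_wk_1[OF ty] sub_comp[OF _ sub] by auto
  moreover have "tm (A # \<Gamma>) (Var 0) (subst (wk (Suc 0)) A)"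
    using var[of "A # \<Gamma>" 0] ty ty_ctx[OF ty] by (simp add: weaken_subst)
  then have "tm (A # \<Gamma>) (Var 0) (subst (wk (Suc 0)) B)"
    using sub_eqty[OF eq sub_wk_1[OF ty]] by (rule HasType_conv)
  ultimately show ?case
    using Cons.prems \<Delta> by (auto simp: sub_Cons)
qed

lemma judgement_conv: "(\<Delta>, X) \<in> T \<Longrightarrow> sub \<Gamma> Var \<Delta> \<Longrightarrow> (\<Gamma>, X) \<in> T"
  using sub_judgement[of \<Delta> X \<Gamma> Var] assertion.map_ident[of X]
  by (simp add: id_def[symmetric] subst_Var[abs_def]
      cong: assertion.map_cong)

lemma eq_ctx_sym: "eq_ctx T \<Gamma> \<Delta> \<Longrightarrow> is_ctx T \<Gamma> \<Longrightarrow> is_ctx T \<Delta> \<Longrightarrow> eq_ctx T \<Delta> \<Gamma>"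
proof (induction \<Gamma> arbitrary: \<Delta>)
  case Nil
  then show ?case by (cases \<Delta>) auto
next
  case (Cons A \<Gamma>)
  then obtain B \<Delta>' where \<Delta>: "\<Delta> = B # \<Delta>'"
    by (cases \<Delta>) auto
  with Cons have eq: "eq_ctx T \<Delta>' \<Gamma>"
    by auto
  then have "sub \<Delta>' Var \<Gamma>"
    using Cons.prems \<Delta> by (auto intro: eq_ctx_sub)
  then show ?case
    using Cons.prems \<Delta> eq by (auto intro: judgement_conv EqType_sym)
qed

lemma eq_ctx_trans:
  "eq_ctx T \<Gamma> \<Delta> \<Longrightarrow> eq_ctx T \<Delta> \<Xi> \<Longrightarrow> is_ctx T \<Gamma> \<Longrightarrow> is_ctx T \<Delta> \<Longrightarrow> is_ctx T \<Xi> \<Longrightarrow> eq_ctx T \<Gamma> \<Xi>"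
proof (induction \<Gamma> arbitrary: \<Delta> \<Xi>)
  case Nil
  then show ?case by (cases \<Delta>; cases \<Xi>) auto
next
  case (Cons A \<Gamma>)
  from Cons.prems obtain B \<Delta>' C \<Xi>' where \<Delta>: "\<Delta> = B # \<Delta>'" "\<Xi> = C # \<Xi>'"
    by (cases \<Delta>; cases \<Xi>) auto
  have "sub \<Gamma> Var \<Delta>'"
    using Cons.prems \<Delta> by (auto intro: eq_ctx_sub)
  then have "eqty \<Gamma> B C"
    using Cons.prems \<Delta> by (auto intro: judgement_conv)
  then show ?case
    using Cons \<Delta> by (auto intro: EqType_trans)
qed

lemma sub_up:
  assumes "sub \<Phi> \<sigma> \<Psi>" "is_ctx T (\<Delta> @ \<Psi>)"
  shows "sub (subst_ctx \<sigma> \<Delta> @ \<Phi>) (up (length \<Delta>) \<sigma>) (\<Delta> @ \<Psi>)"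
  using assms(2)
proof (induction \<Delta>)
  case (Cons A \<Delta>)
  then show ?case
    using sub_lift[of "subst_ctx \<sigma> \<Delta> @ \<Phi>" "up (length \<Delta>) \<sigma>" "\<Delta> @ \<Psi>" A] by (simp add: up_Suc)
qed (simp add: assms(1))

lemma is_ctx_append: "is_ctx T (\<Delta> @ \<Gamma>) \<Longrightarrow> is_ctx T \<Gamma>"
  by (induction \<Delta>) auto

lemma tm_Var: "is_ctx T \<Gamma> \<Longrightarrow> i < length \<Gamma> \<Longrightarrow> A = weaken (Suc i) (\<Gamma> ! i) \<Longrightarrow> tm \<Gamma> (Var i) A"
  using var by simp

text \<open>Replaces a term by an equal one inside a type: the type is first written over a fresh
  last variable and then both terms are substituted for it. Congruence of \<open>Idt\<close> is
  obtained in this way.\<close>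

lemma eqsub_scons_right: "eqtm \<Gamma> a b A \<Longrightarrow> ty \<Gamma> A \<Longrightarrow> eqsub \<Gamma> (a \<cdot> Var) (b \<cdot> Var) (A # \<Gamma>)"
  by (rule eqsub_scons) (auto intro: eqsub_refl sub_Var ty_ctx)

end


section \<open>Weak factorisation systems from display maps\<close>

definition is_pullback :: "('o, 'm) cat \<Rightarrow> 'm \<Rightarrow> 'm \<Rightarrow> 'm \<Rightarrow> 'm \<Rightarrow> bool" where
  "is_pullback C p q f g \<longleftrightarrow>
    p \<in> ar C \<and> q \<in> ar C \<and> f \<in> ar C \<and> g \<in> ar C \<and>
    src C p = src C q \<and> tgt C p = src C f \<and> tgt C q = src C g \<and> tgt C f = tgt C g \<and>
    cmp C f p = cmp C g q \<and>
    (\<forall>X. \<forall>h \<in> hom_set C X (src C f). \<forall>k \<in> hom_set C X (src C g). cmp C f h = cmp C g k \<longrightarrow>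
      (\<exists>!j. j \<in> hom_set C X (src C p) \<and> cmp C p j = h \<and> cmp C q j = k))"

lemma is_pullbackD:
  assumes "is_pullback C p q f g" "p \<in> hom_set C P A" "q \<in> hom_set C P B"
    "h \<in> hom_set C X A" "k \<in> hom_set C X B" "cmp C f h = cmp C g k"
  shows "\<exists>!j. j \<in> hom_set C X P \<and> cmp C p j = h \<and> cmp C q j = k"
proof -
  have "src C f = A" "src C g = B" "src C p = P"
    using assms(1-3) by (auto simp: is_pullback_def hom_set_def)
  then show ?thesis
    using assms(1,4-6) unfolding is_pullback_def by metis
qed

section \<open>Closure properties of the lifting classes\<close>

context category
begin

lemma liftsD:
  assumes "lifts C f g" "f \<in> hom_set C A B" "g \<in> hom_set C X Y"
    "h \<in> hom_set C A X" "k \<in> hom_set C B Y" "cmp C g h = cmp C k f"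
  obtains j where "j \<in> hom_set C B X" "cmp C j f = h" "cmp C g j = k"
proof -
  have "src C f = A" "tgt C f = B" "src C g = X" "tgt C g = Y"
    using assms(2,3) by (auto simp: hom_set_def)
  then show ?thesis
    using assms(1,4-6) that unfolding lifts_def by blast
qed

lemma liftsI:
  assumes "f \<in> hom_set C A B" "g \<in> hom_set C X Y"
    "\<And>h k. h \<in> hom_set C A X \<Longrightarrow> k \<in> hom_set C B Y \<Longrightarrow> cmp C g h = cmp C k f \<Longrightarrow>
      \<exists>j \<in> hom_set C B X. cmp C j f = h \<and> cmp C g j = k"
  shows "lifts C f g"
  using assms unfolding lifts_def by (auto simp: hom_set_def)

lemma cmp_in_ar: "f \<in> hom_set C X Y \<Longrightarrow> g \<in> hom_set C Y Z \<Longrightarrow> cmp C g f \<in> ar C"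
  using cmp_hom by (auto simp: hom_set_def)

lemma llp_comp:
  assumes "f \<in> llp C R" "g \<in> llp C R" "R \<subseteq> ar C" "tgt C f = src C g"
  shows "cmp C g f \<in> llp C R"
proof -
  obtain A B D where f: "f \<in> hom_set C A B" and g: "g \<in> hom_set C B D"
    using assms unfolding llp_def hom_set_def by blast
  have "lifts C (cmp C g f) r" if "r \<in> R" for r
  proof -
    obtain X Y where r: "r \<in> hom_set C X Y"
      using \<open>r \<in> R\<close> assms(3) by (auto simp: hom_set_def)
    show ?thesis
    proof (rule liftsI[OF cmp_hom[OF f g] r])
      fix h k
      assume h: "h \<in> hom_set C A X" and k: "k \<in> hom_set C D Y"
        and eq: "cmp C r h = cmp C k (cmp C g f)"
      have "lifts C f r" "lifts C g r"
        using assms \<open>r \<in> R\<close> by (auto simp: llp_def)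
      have "cmp C r h = cmp C (cmp C k g) f"
        using eq cmp_assoc[OF f g k] by simp
      then obtain j where j: "j \<in> hom_set C B X" "cmp C j f = h" "cmp C r j = cmp C k g"
        by (rule liftsD[OF \<open>lifts C f r\<close> f r h cmp_hom[OF g k]])
      obtain l where l: "l \<in> hom_set C D X" "cmp C l g = j" "cmp C r l = k"
        by (rule liftsD[OF \<open>lifts C g r\<close> g r j(1) k j(3)])
      then show "\<exists>j \<in> hom_set C D X. cmp C j (cmp C g f) = h \<and> cmp C r j = k"
        using cmp_assoc[OF f g l(1)] j(2) by (intro bexI[OF _ l(1)]) simp
    qed
  qed
  then show ?thesis
    using cmp_in_ar[OF f g] by (simp add: llp_def)
qed

lemma rlp_comp:
  assumes "p \<in> rlp C L" "q \<in> rlp C L" "L \<subseteq> ar C" "tgt C p = src C q"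
  shows "cmp C q p \<in> rlp C L"
proof -
  obtain X Y Z where p: "p \<in> hom_set C X Y" and q: "q \<in> hom_set C Y Z"
    using assms unfolding rlp_def hom_set_def by blast
  have "lifts C i (cmp C q p)" if "i \<in> L" for i
  proof -
    obtain A B where i: "i \<in> hom_set C A B"
      using \<open>i \<in> L\<close> assms(3) by (auto simp: hom_set_def)
    show ?thesis
    proof (rule liftsI[OF i cmp_hom[OF p q]])
      fix h k
      assume h: "h \<in> hom_set C A X" and k: "k \<in> hom_set C B Z"
        and eq: "cmp C (cmp C q p) h = cmp C k i"
      have "lifts C i p" "lifts C i q"
        using assms \<open>i \<in> L\<close> by (auto simp: rlp_def)
      have "cmp C q (cmp C p h) = cmp C k i"
        using eq cmp_assoc[OF h p q] by simp
      then obtain j where j: "j \<in> hom_set C B Y" "cmp C j i = cmp C p h" "cmp C q j = k"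
        by (rule liftsD[OF \<open>lifts C i q\<close> i q cmp_hom[OF h p] k])
      obtain l where l: "l \<in> hom_set C B X" "cmp C l i = h" "cmp C p l = j"
        by (rule liftsD[OF \<open>lifts C i p\<close> i p h j(1) j(2)[symmetric]])
      then show "\<exists>j \<in> hom_set C B X. cmp C j i = h \<and> cmp C (cmp C q p) j = k"
        using cmp_assoc[OF l(1) p q] j(3) by (intro bexI[OF _ l(1)]) simp
    qed
  qed
  then show ?thesis
    using cmp_in_ar[OF p q] by (simp add: rlp_def)
qed

lemma rlp_ident:
  assumes "L \<subseteq> ar C" "X \<in> ob C"
  shows "ident C X \<in> rlp C L"
proof -
  note id = ident_hom[OF assms(2)]
  have "lifts C i (ident C X)" if "i \<in> L" for i
  proof -
    obtain A B where i: "i \<in> hom_set C A B"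
      using \<open>i \<in> L\<close> assms(1) by (auto simp: hom_set_def)
    show ?thesis
      by (rule liftsI[OF i id]) (metis cmp_ident_left)
  qed
  then show ?thesis
    using id by (simp add: rlp_def hom_set_def)
qed

lemma llp_ident:
  assumes "R \<subseteq> ar C" "X \<in> ob C"
  shows "ident C X \<in> llp C R"
proof -
  note id = ident_hom[OF assms(2)]
  have "lifts C (ident C X) r" if "r \<in> R" for r
  proof -
    obtain A B where r: "r \<in> hom_set C A B"
      using \<open>r \<in> R\<close> assms(1) by (auto simp: hom_set_def)
    show ?thesis
      by (rule liftsI[OF id r]) (metis cmp_ident_right)
  qed
  then show ?thesis
    using id by (simp add: llp_def hom_set_def)
qed

lemma rlp_pullback:
  assumes "p \<in> rlp C L" "L \<subseteq> ar C" "is_pullback C d' p' p d"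
  shows "p' \<in> rlp C L"
proof -
  obtain P E A B where d': "d' \<in> hom_set C P E" and p': "p' \<in> hom_set C P A"
    and p: "p \<in> hom_set C E B" and d: "d \<in> hom_set C A B"
    and comm: "cmp C p d' = cmp C d p'"
    using assms(3) by (auto simp: is_pullback_def hom_set_def)
  have univ: "\<exists>!j. j \<in> hom_set C X P \<and> cmp C d' j = h \<and> cmp C p' j = k"
    if "h \<in> hom_set C X E" "k \<in> hom_set C X A" "cmp C p h = cmp C d k" for X h k
    by (rule is_pullbackD[OF assms(3) d' p' that])
  have "lifts C i p'" if "i \<in> L" for i
  proof -
    obtain X Y where i: "i \<in> hom_set C X Y"
      using \<open>i \<in> L\<close> assms(2) by (auto simp: hom_set_def)
    have "lifts C i p"
      using \<open>i \<in> L\<close> assms(1) by (simp add: rlp_def)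
    show ?thesis
    proof (rule liftsI[OF i p'])
      fix h k
      assume h: "h \<in> hom_set C X P" and k: "k \<in> hom_set C Y A"
        and eq: "cmp C p' h = cmp C k i"
      have "cmp C p (cmp C d' h) = cmp C (cmp C d k) i"
        using comm eq cmp_assoc[OF h d' p] cmp_assoc[OF h p' d] cmp_assoc[OF i k d] by simp
      then obtain l where l: "l \<in> hom_set C Y E" "cmp C l i = cmp C d' h" "cmp C p l = cmp C d k"
        by (rule liftsD[OF \<open>lifts C i p\<close> i p cmp_hom[OF h d'] cmp_hom[OF k d]])
      then obtain j where j: "j \<in> hom_set C Y P" "cmp C d' j = l" "cmp C p' j = k"
        using univ[OF l(1) k] by blast
      have ji: "cmp C j i \<in> hom_set C X P" "cmp C d' (cmp C j i) = cmp C d' h"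
        "cmp C p' (cmp C j i) = cmp C p' h"
        using j l eq cmp_hom[OF i j(1)] cmp_assoc[OF i j(1) d'] cmp_assoc[OF i j(1) p'] by simp_all
      \<comment> \<open>The upper triangle is an equation between maps into the pullback, so it is
        tested on both projections and follows from uniqueness.\<close>
      have "cmp C p (cmp C d' h) = cmp C d (cmp C p' h)"
        using comm cmp_assoc[OF h d' p] cmp_assoc[OF h p' d] by simp
      from univ[OF cmp_hom[OF h d'] cmp_hom[OF h p'] this] have "cmp C j i = h"
        using ji h by blast
      with j show "\<exists>j \<in> hom_set C Y P. cmp C j i = h \<and> cmp C p' j = k"
        by blast
    qed
  qed
  then show ?thesis
    using p' by (simp add: rlp_def hom_set_def)
qed

end

text \<open>Objects with a finite tower of display maps down to \<open>t\<close>. This is the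
  abstract counterpart of a context built by successive extensions, and its induction principle
  replaces induction on the length of a context.\<close>

inductive_set fibrant :: "('o, 'm) cat \<Rightarrow> 'm set \<Rightarrow> 'o \<Rightarrow> 'o set" for C D t where
  terminal: "t \<in> fibrant C D t"
| display: "d \<in> D \<Longrightarrow> tgt C d \<in> fibrant C D t \<Longrightarrow> src C d \<in> fibrant C D t"

text \<open>The last assumption holds in a type theory because a section \<open>s\<close> of a display map, i.e. a
  term \<open>b\<close> of a type \<open>B\<close> over \<open>\<Gamma>\<close>, factors through the context \<open>(\<Gamma>, y \<in> B, u \<in> Id\<^sub>B(b, y))\<close>.\<close>

locale display_category = category C
  for C :: "('o, 'm) cat" +
  fixes D :: "'m set" and t :: 'o
  assumes display_ar: "D \<subseteq> ar C"
    and terminal_ob: "t \<in> ob C"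
    and terminal_hom: "X \<in> ob C \<Longrightarrow> \<exists>!f. f \<in> hom_set C X t"
    and all_fibrant: "ob C \<subseteq> fibrant C D t"
    and display_pullback:
      "d \<in> D \<Longrightarrow> f \<in> ar C \<Longrightarrow> tgt C f = tgt C d \<Longrightarrow> \<exists>d' \<in> D. \<exists>f'. is_pullback C d' f' f d"
    and section_factorisation: "d \<in> D \<Longrightarrow> s \<in> hom_set C (tgt C d) (src C d) \<Longrightarrow>
      cmp C d s = ident C (tgt C d) \<Longrightarrow>
      \<exists>i \<in> llp C D. \<exists>p \<in> D.
        src C i = src C s \<and> tgt C i = src C p \<and> tgt C p = tgt C s \<and> s = cmp C p i"
begin

abbreviation "anodyne \<equiv> llp C D"
abbreviation "fibrations \<equiv> rlp C anodyne"

lemma anodyne_ar: "anodyne \<subseteq> ar C"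
  by (auto simp: llp_def)

lemma display_fibration: "D \<subseteq> fibrations"
  using display_ar by (auto simp: llp_def rlp_def)

text \<open>Maps into the terminal object are unique, so \<open>f\<close> is the composite of the
  display maps in the tower of \<open>X\<close>.\<close>

lemma to_terminal_fibration:
  assumes "X \<in> ob C" "f \<in> hom_set C X t"
  shows "f \<in> fibrations"
proof -
  have "X \<in> fibrant C D t"
    using assms(1) all_fibrant by blast
  then show ?thesis
    using assms(2)
  proof (induction arbitrary: f)
    case terminal
    then have "f = ident C t"
      using terminal_hom[OF terminal_ob] ident_hom[OF terminal_ob] by blast
    then show ?case
      using rlp_ident[OF anodyne_ar terminal_ob] by simp
  next
    case (display d)
    have d: "d \<in> hom_set C (src C d) (tgt C d)"
      using display.hyps display_ar by (auto simp: hom_set_def)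
    then have "tgt C d \<in> ob C" "src C d \<in> ob C"
      by (auto simp: hom_set_def intro: tgt_ob src_ob)
    then obtain g where g: "g \<in> hom_set C (tgt C d) t"
      using terminal_hom by blast
    have "f = cmp C g d"
      using terminal_hom[OF \<open>src C d \<in> ob C\<close>] display.prems cmp_hom[OF d g] by blast
    moreover have "g \<in> fibrations" "d \<in> fibrations"
      using display.IH[OF g] display.hyps display_fibration by auto
    ultimately show ?case
      using rlp_comp[OF _ _ anodyne_ar] g by (simp add: hom_set_def)
  qed
qed

text \<open>Induction on the tower of display maps below the codomain. Given a factorisation \<open>p i\<close> of
  \<open>d f\<close>, the left lifting property of \<open>i\<close> extends \<open>f\<close> to a section of the pullback of \<open>d\<close> along \<open>p\<close>,
  and sections can be factorised.\<close>

lemma factorisation: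
  assumes "f \<in> hom_set C X Y"
  shows "\<exists>i \<in> anodyne. \<exists>p \<in> fibrations. \<exists>E.
    i \<in> hom_set C X E \<and> p \<in> hom_set C E Y \<and> f = cmp C p i"
proof -
  have X: "X \<in> ob C" and "Y \<in> ob C"
    using assms src_ob tgt_ob by (auto simp: hom_set_def)
  then have "Y \<in> fibrant C D t"
    using all_fibrant by blast
  then show ?thesis
    using assms
  proof (induction arbitrary: f)
    \<comment> \<open>Over \<open>t\<close> the identity followed by \<open>f\<close> is already a
      factorisation.\<close>
    case terminal
    then show ?case
      using llp_ident[OF display_ar X] to_terminal_fibration[OF X] ident_hom[OF X] cmp_ident_right
      by metis
  next
    case (display d)
    note f = display.prems
    have d: "d \<in> hom_set C (src C d) (tgt C d)"
      using display.hyps display_ar by (auto simp: hom_set_def)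
    from display.IH[OF cmp_hom[OF f d]] obtain i p E where
      i: "i \<in> anodyne" "i \<in> hom_set C X E" and p: "p \<in> fibrations" "p \<in> hom_set C E (tgt C d)"
      and df: "cmp C d f = cmp C p i"
      by blast
    obtain d' p' where "d' \<in> D" and pb: "is_pullback C d' p' p d"
      using display_pullback[OF display.hyps(1), of p] p by (auto simp: hom_set_def)
    obtain P where d': "d' \<in> hom_set C P E" and p': "p' \<in> hom_set C P (src C d)"
      using pb p by (auto simp: is_pullback_def hom_set_def)
    obtain g where g: "g \<in> hom_set C X P" "cmp C d' g = i" "cmp C p' g = f"
      using is_pullbackD[OF pb d' p' i(2) f df[symmetric]] by blast
    have E: "E \<in> ob C"
      using d' tgt_ob by (auto simp: hom_set_def)
    have "lifts C i d'"
      using i \<open>d' \<in> D\<close> by (simp add: llp_def)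
    then obtain s where s: "s \<in> hom_set C E P" "cmp C s i = g" "cmp C d' s = ident C E"
      using liftsD[OF _ i(2) d' g(1) ident_hom[OF E]] g(2) cmp_ident_left[OF i(2)] by metis
    then obtain r q where r: "r \<in> anodyne" and q: "q \<in> D" and
      rq: "src C r = E" "tgt C r = src C q" "tgt C q = P" "s = cmp C q r"
      using section_factorisation[OF \<open>d' \<in> D\<close>, of s] d' by (auto simp: hom_set_def)
    have rh: "r \<in> hom_set C E (src C q)" and qh: "q \<in> hom_set C (src C q) P"
      using r q rq display_ar anodyne_ar by (auto simp: hom_set_def)
    have "cmp C (cmp C p' q) (cmp C r i) = cmp C p' (cmp C (cmp C q r) i)"
      using cmp_assoc[OF cmp_hom[OF i(2) rh] qh p'] cmp_assoc[OF i(2) rh qh] by simp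
    also have "\<dots> = f"
      using rq s g by simp
    finally have "f = cmp C (cmp C p' q) (cmp C r i)"
      by simp
    moreover have "cmp C r i \<in> anodyne"
      using llp_comp[OF i(1) r display_ar] i rq by (simp add: hom_set_def)
    \<comment> \<open>The pullback square serves in both directions: \<open>d'\<close> is a display
      map, so \<open>i\<close> lifts against it, and \<open>p'\<close> is a base change of the
      fibration \<open>p\<close>, hence a fibration.\<close>
    moreover have "cmp C p' q \<in> fibrations"
      using rlp_comp[OF _ rlp_pullback[OF p(1) anodyne_ar pb] anodyne_ar] q display_fibration p' rq
      by (auto simp: hom_set_def)
    ultimately show ?case
      using cmp_hom[OF i(2) rh] cmp_hom[OF qh p'] by blast
  qed
qed

theorem wfs: "weak_factorisation_system C anodyne fibrations"
proof unfold_locales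
  show "anodyne \<subseteq> ar C" "fibrations \<subseteq> ar C"
    by (auto simp: llp_def rlp_def)
  \<comment> \<open>The Galois connection between the two lifting operators: anodyne maps lift
    against fibrations by definition, and fibrations include all display maps.\<close>
  show "llp C fibrations = anodyne"
    using display_fibration by (auto simp: llp_def rlp_def)
  show "\<exists>i \<in> anodyne. \<exists>p \<in> fibrations.
      src C i = src C f \<and> tgt C i = src C p \<and> tgt C p = tgt C f \<and> f = cmp C p i"
    if "f \<in> ar C" for f
  proof -
    have "f \<in> hom_set C (src C f) (tgt C f)"
      using that by (simp add: hom_set_def)
    from factorisation[OF this] show ?thesis
      unfolding hom_set_def by (smt (verit, ccfv_threshold) mem_Collect_eq)
  qed
qed simp

end


section \<open>The classifying category\<close>

context type_theory
begin

definition eqc :: "'f ctx \<Rightarrow> 'f ctx \<Rightarrow> bool" where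
  "eqc \<Gamma> \<Delta> \<longleftrightarrow> is_ctx T \<Gamma> \<and> is_ctx T \<Delta> \<and> eq_ctx T \<Gamma> \<Delta>"

lemma eqc_refl [simp]: "eqc \<Gamma> \<Gamma> \<longleftrightarrow> is_ctx T \<Gamma>"
  by (auto simp: eqc_def eq_ctx_refl)

lemma eqc_sym: "eqc \<Gamma> \<Delta> \<Longrightarrow> eqc \<Delta> \<Gamma>"
  by (auto simp: eqc_def intro: eq_ctx_sym)

lemma eqc_trans: "eqc \<Gamma> \<Delta> \<Longrightarrow> eqc \<Delta> \<Xi> \<Longrightarrow> eqc \<Gamma> \<Xi>"
  by (auto simp: eqc_def intro: eq_ctx_trans)

lemma eqc_length: "eqc \<Gamma> \<Delta> \<Longrightarrow> length \<Gamma> = length \<Delta>"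
proof -
  have "eq_ctx T \<Gamma> \<Delta> \<Longrightarrow> length \<Gamma> = length \<Delta>"
  proof (induction \<Gamma> arbitrary: \<Delta>)
    case Nil
    then show ?case by (cases \<Delta>) auto
  next
    case (Cons A \<Gamma>)
    then show ?case by (cases \<Delta>) auto
  qed
  then show "eqc \<Gamma> \<Delta> \<Longrightarrow> length \<Gamma> = length \<Delta>"
    by (simp add: eqc_def)
qed

lemma eqc_sub: "eqc \<Gamma> \<Delta> \<Longrightarrow> sub \<Gamma> Var \<Delta>"
  by (auto simp: eqc_def intro: eq_ctx_sub)

lemma sub_conv:
  assumes "sub \<Phi> \<sigma> \<Psi>" "eqc \<Phi> \<Phi>'" "eqc \<Psi> \<Psi>'"
  shows "sub \<Phi>' \<sigma> \<Psi>'"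
  using sub_comp[OF sub_comp[OF eqc_sub[OF eqc_sym[OF assms(2)]] assms(1)] eqc_sub[OF assms(3)]]
  by simp

lemma eqsub_conv:
  assumes "eqsub \<Phi> \<sigma> \<tau> \<Psi>" "eqc \<Phi> \<Phi>'" "eqc \<Psi> \<Psi>'"
  shows "eqsub \<Phi>' \<sigma> \<tau> \<Psi>'"
  using eqsub_comp_right[OF eqsub_comp_left[OF assms(1) eqc_sub[OF eqc_sym[OF assms(2)]]]
      eqc_sub[OF assms(3)]]
  by simp

lemma ctx_rel_iff: "(\<Gamma>, \<Delta>) \<in> ctx_rel T \<longleftrightarrow> eqc \<Gamma> \<Delta>"
  by (simp add: ctx_rel_def eqc_def)

lemma mor_rel_iff: "((\<Phi>, f, \<Psi>), (\<Phi>', f', \<Psi>')) \<in> mor_rel T \<longleftrightarrow>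
    eqc \<Phi> \<Phi>' \<and> eqc \<Psi> \<Psi>' \<and> length f = length \<Psi> \<and> length f' = length \<Psi> \<and>
    eqsub \<Phi> (tup f) (tup f') \<Psi>" (is "?l \<longleftrightarrow> ?r")
proof
  assume ?l
  then show ?r
    by (auto simp: mor_rel_def mors_def is_mor_iff_sub eq_mor_iff_eqsub eqc_def
        dest: sub_ctx_left sub_ctx_right)
next
  assume r: ?r
  then have "sub \<Phi>' (tup f') \<Psi>'"
    by (blast intro: sub_conv eqsub_right)
  with r show ?l
    using eqc_length[of \<Psi> \<Psi>']
    by (auto simp: mor_rel_def mors_def is_mor_iff_sub eq_mor_iff_eqsub eqc_def
        intro: eqsub_left)
qed

lemma equiv_mor_rel: "equiv (mors T) (mor_rel T)"
proof (rule equivI)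
  show "mor_rel T \<subseteq> mors T \<times> mors T"
    by (auto simp: mor_rel_def)
  show "refl_on (mors T) (mor_rel T)"
    by (auto simp: refl_on_def mor_rel_iff mors_def is_mor_iff_sub
        intro: eqsub_refl sub_ctx_left sub_ctx_right)
  show "sym (mor_rel T)"
    unfolding sym_def by (auto simp: mor_rel_iff eqc_length intro: eqc_sym eqsub_sym eqsub_conv)
  have "eqsub \<Phi> \<sigma> \<rho> \<Psi>" if "eqsub \<Phi> \<sigma> \<tau> \<Psi>" "eqsub \<Phi>' \<tau> \<rho> \<Psi>'" "eqc \<Phi> \<Phi>'" "eqc \<Psi> \<Psi>'"
    for \<Phi> \<Phi>' \<Psi> \<Psi>' \<sigma> \<tau> \<rho>
    using that by (meson eqsub_trans eqsub_conv eqc_sym)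
  then show "trans (mor_rel T)"
    unfolding trans_def by (fastforce simp: mor_rel_iff eqc_length intro: eqc_trans)
qed

section \<open>Objects and arrows as equivalence classes\<close>

definition cc :: "'f ctx \<Rightarrow> 'f ctx set" where
  "cc \<Gamma> = ctx_class T \<Gamma>"

text \<open>Hides the quotient: every arrow has this form (\<open>ar_CC\<close>), composition acts
  on the functions (\<open>cmp_mc\<close>), and equations between arrows become \<open>eqsub\<close>
  statements (\<open>mc_eq_iff\<close>).\<close>

definition mc :: "'f ctx \<Rightarrow> (nat \<Rightarrow> 'f expr) \<Rightarrow> 'f ctx \<Rightarrow> 'f mor set" where
  "mc \<Phi> \<sigma> \<Psi> = mor_class T \<Phi> (map \<sigma> [0..<length \<Psi>]) \<Psi>"

abbreviation "CC \<equiv> classifying_category T"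

lemma mem_cc: "\<Delta> \<in> cc \<Gamma> \<longleftrightarrow> eqc \<Gamma> \<Delta>"
  by (simp add: cc_def ctx_class_def ctx_rel_iff)

lemma cc_eq_iff: "is_ctx T \<Gamma> \<Longrightarrow> cc \<Gamma> = cc \<Delta> \<longleftrightarrow> eqc \<Gamma> \<Delta>"
  by (auto simp: set_eq_iff mem_cc intro: eqc_trans eqc_sym)

lemma cc_eq: "eqc \<Gamma> \<Delta> \<Longrightarrow> cc \<Delta> = cc \<Gamma>"
  by (auto simp: set_eq_iff mem_cc intro: eqc_trans eqc_sym)

lemma eqsub_cong:
  "(\<And>i. i < length \<Psi> \<Longrightarrow> \<sigma> i = \<sigma>' i) \<Longrightarrow> (\<And>i. i < length \<Psi> \<Longrightarrow> \<tau> i = \<tau>' i) \<Longrightarrow>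
    eqsub \<Phi> \<sigma> \<tau> \<Psi> = eqsub \<Phi> \<sigma>' \<tau>' \<Psi>"
  unfolding eqsub_def by (metis atLeastLessThan_iff map_cong set_upt)

lemma mem_mc: "(\<Phi>', f, \<Psi>') \<in> mc \<Phi> \<sigma> \<Psi> \<longleftrightarrow>
    eqc \<Phi> \<Phi>' \<and> eqc \<Psi> \<Psi>' \<and> length f = length \<Psi> \<and> eqsub \<Phi> \<sigma> (tup f) \<Psi>"
proof -
  have "eqsub \<Phi> (tup (map \<sigma> [0..<length \<Psi>])) (tup f) \<Psi> = eqsub \<Phi> \<sigma> (tup f) \<Psi>"
    by (rule eqsub_cong) (simp_all add: tup_map)
  then show ?thesis
    by (simp add: mc_def mor_class_def mor_rel_iff)
qed

lemma mor_class_tup: "length f = length \<Psi> \<Longrightarrow> mor_class T \<Phi> f \<Psi> = mc \<Phi> (tup f) \<Psi>"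
  using map_tup[of f] by (simp add: mc_def)

lemma mc_rel_iff:
  "((\<Phi>, map \<sigma> [0..<length \<Psi>], \<Psi>), (\<Phi>', map \<sigma>' [0..<length \<Psi>'], \<Psi>')) \<in> mor_rel T \<longleftrightarrow>
    eqc \<Phi> \<Phi>' \<and> eqc \<Psi> \<Psi>' \<and> eqsub \<Phi> \<sigma> \<sigma>' \<Psi>"
proof (cases "eqc \<Psi> \<Psi>'")
  case True
  have "eqsub \<Phi> (tup (map \<sigma> [0..<length \<Psi>])) (tup (map \<sigma>' [0..<length \<Psi>'])) \<Psi> =
      eqsub \<Phi> \<sigma> \<sigma>' \<Psi>"
    using eqc_length[OF True] by (intro eqsub_cong) (simp_all add: tup_map)
  then show ?thesis
    using eqc_length[OF True] by (auto simp: mor_rel_iff)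
qed (simp add: mor_rel_iff)

lemma mc_eq_iff:
  assumes "sub \<Phi> \<sigma> \<Psi>"
  shows "mc \<Phi> \<sigma> \<Psi> = mc \<Phi>' \<sigma>' \<Psi>' \<longleftrightarrow> eqc \<Phi> \<Phi>' \<and> eqc \<Psi> \<Psi>' \<and> eqsub \<Phi> \<sigma> \<sigma>' \<Psi>"
proof -
  have "(\<Phi>, map \<sigma> [0..<length \<Psi>], \<Psi>) \<in> mors T"
    using assms by (simp add: mors_def sub_def)
  note self = equiv_class_self[OF equiv_mor_rel this]
  have "mc \<Phi> \<sigma> \<Psi> = mc \<Phi>' \<sigma>' \<Psi>' \<longleftrightarrow>
      ((\<Phi>, map \<sigma> [0..<length \<Psi>], \<Psi>), (\<Phi>', map \<sigma>' [0..<length \<Psi>'], \<Psi>')) \<in> mor_rel T"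
    (is "_ \<longleftrightarrow> (?x, ?y) \<in> _")
  proof
    assume "mc \<Phi> \<sigma> \<Psi> = mc \<Phi>' \<sigma>' \<Psi>'"
    with self have "(?y, ?x) \<in> mor_rel T"
      unfolding mc_def mor_class_def by blast
    then show "(?x, ?y) \<in> mor_rel T"
      using equiv_mor_rel by (blast elim: equivE symE)
  next
    assume "(?x, ?y) \<in> mor_rel T"
    then show "mc \<Phi> \<sigma> \<Psi> = mc \<Phi>' \<sigma>' \<Psi>'"
      unfolding mc_def mor_class_def by (rule equiv_class_eq[OF equiv_mor_rel])
  qed
  then show ?thesis
    by (simp add: mc_rel_iff)
qed

lemma mc_eqI: "eqsub \<Phi> \<sigma> \<tau> \<Psi> \<Longrightarrow> mc \<Phi> \<sigma> \<Psi> = mc \<Phi> \<tau> \<Psi>"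
  by (auto simp: mc_eq_iff[OF eqsub_left] dest: eqsub_left sub_ctx_left sub_ctx_right)

lemma mc_eqD: "sub \<Phi> \<sigma> \<Psi> \<Longrightarrow> mc \<Phi> \<sigma> \<Psi> = mc \<Phi>' \<tau> \<Psi>' \<Longrightarrow> eqsub \<Phi> \<sigma> \<tau> \<Psi>"
  by (simp add: mc_eq_iff)

lemma mc_conv: "sub \<Phi> \<sigma> \<Psi> \<Longrightarrow> eqc \<Phi> \<Phi>' \<Longrightarrow> eqc \<Psi> \<Psi>' \<Longrightarrow> mc \<Phi> \<sigma> \<Psi> = mc \<Phi>' \<sigma> \<Psi>'"
  by (simp add: mc_eq_iff eqsub_refl)

lemma mc_self: "sub \<Phi> \<sigma> \<Psi> \<Longrightarrow> (\<Phi>, map \<sigma> [0..<length \<Psi>], \<Psi>) \<in> mc \<Phi> \<sigma> \<Psi>"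
  unfolding mc_def mor_class_def
  by (rule equiv_class_self[OF equiv_mor_rel]) (simp add: mors_def sub_def)

lemma ob_CC: "ob CC = {cc \<Gamma> | \<Gamma>. is_ctx T \<Gamma>}"
  by (auto simp: classifying_category_def quotient_def cc_def ctx_class_def)

lemma ar_CC: "ar CC = {mc \<Phi> \<sigma> \<Psi> | \<Phi> \<sigma> \<Psi>. sub \<Phi> \<sigma> \<Psi>}"
proof -
  have "ar CC = {mor_class T \<Phi> f \<Psi> | \<Phi> f \<Psi>. is_mor T \<Phi> f \<Psi>}"
    by (auto simp: classifying_category_def quotient_def mor_class_def mors_def)
  also have "\<dots> = {mc \<Phi> \<sigma> \<Psi> | \<Phi> \<sigma> \<Psi>. sub \<Phi> \<sigma> \<Psi>}"
  proof (intro set_eqI iffI)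
    fix F
    assume "F \<in> {mor_class T \<Phi> f \<Psi> | \<Phi> f \<Psi>. is_mor T \<Phi> f \<Psi>}"
    then show "F \<in> {mc \<Phi> \<sigma> \<Psi> | \<Phi> \<sigma> \<Psi>. sub \<Phi> \<sigma> \<Psi>}"
      using mor_class_tup is_mor_iff_sub by fastforce
  next
    fix F
    assume "F \<in> {mc \<Phi> \<sigma> \<Psi> | \<Phi> \<sigma> \<Psi>. sub \<Phi> \<sigma> \<Psi>}"
    then show "F \<in> {mor_class T \<Phi> f \<Psi> | \<Phi> f \<Psi>. is_mor T \<Phi> f \<Psi>}"
      by (auto simp: mc_def sub_def)
  qed
  finally show ?thesis .
qed

lemma src_mc:
  assumes "sub \<Phi> \<sigma> \<Psi>"
  shows "src CC (mc \<Phi> \<sigma> \<Psi>) = cc \<Phi>"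
proof -
  have "src CC (mc \<Phi> \<sigma> \<Psi>) = (\<Union>x \<in> mc \<Phi> \<sigma> \<Psi>. cc (fst x))"
    by (simp add: classifying_category_def cc_def case_prod_unfold)
  also have "\<dots> = (\<Union>x \<in> mc \<Phi> \<sigma> \<Psi>. cc \<Phi>)"
    by (intro SUP_cong refl) (clarsimp simp: mem_mc cc_eq)
  also have "\<dots> = cc \<Phi>"
    using mc_self[OF assms] by (subst UN_constant) auto
  finally show ?thesis .
qed

lemma tgt_mc:
  assumes "sub \<Phi> \<sigma> \<Psi>"
  shows "tgt CC (mc \<Phi> \<sigma> \<Psi>) = cc \<Psi>"
proof -
  have "tgt CC (mc \<Phi> \<sigma> \<Psi>) = (\<Union>x \<in> mc \<Phi> \<sigma> \<Psi>. cc (snd (snd x)))"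
    by (simp add: classifying_category_def cc_def case_prod_unfold)
  also have "\<dots> = (\<Union>x \<in> mc \<Phi> \<sigma> \<Psi>. cc \<Psi>)"
    by (intro SUP_cong refl) (clarsimp simp: mem_mc cc_eq)
  also have "\<dots> = cc \<Psi>"
    using mc_self[OF assms] by (subst UN_constant) auto
  finally show ?thesis .
qed

lemma mc_hom: "sub \<Phi> \<sigma> \<Psi> \<Longrightarrow> mc \<Phi> \<sigma> \<Psi> \<in> hom_set CC (cc \<Phi>) (cc \<Psi>)"
  by (auto simp: hom_set_def src_mc tgt_mc ar_CC)

text \<open>The contexts of a representative may be prescribed, by transporting it along equality of
  contexts. Successive arrows can thus share their middle context literally, as
  \<open>cmp_mc\<close> demands.\<close>

lemma hom_cc:
  assumes "F \<in> hom_set CC (cc \<Phi>) (cc \<Psi>)" "is_ctx T \<Phi>" "is_ctx T \<Psi>"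
  obtains \<sigma> where "sub \<Phi> \<sigma> \<Psi>" "F = mc \<Phi> \<sigma> \<Psi>"
proof -
  obtain \<Phi>' \<sigma> \<Psi>' where \<sigma>: "sub \<Phi>' \<sigma> \<Psi>'" "F = mc \<Phi>' \<sigma> \<Psi>'"
    using assms(1) by (auto simp: hom_set_def ar_CC)
  with assms have "eqc \<Phi>' \<Phi>" "eqc \<Psi>' \<Psi>"
    using sub_ctx_left[OF \<sigma>(1)] sub_ctx_right[OF \<sigma>(1)]
    by (auto simp: hom_set_def src_mc tgt_mc cc_eq_iff)
  with \<sigma> show ?thesis
    by (intro that[of \<sigma>]) (simp_all add: mc_conv sub_conv)
qed

lemma homE:
  assumes "F \<in> hom_set CC X Y"
  obtains \<Phi> \<sigma> \<Psi> where "X = cc \<Phi>" "Y = cc \<Psi>" "sub \<Phi> \<sigma> \<Psi>" "F = mc \<Phi> \<sigma> \<Psi>"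
  using assms by (auto simp: hom_set_def ar_CC src_mc tgt_mc)

lemma hom_from_cc:
  assumes "F \<in> hom_set CC (cc \<Phi>) Y" "is_ctx T \<Phi>"
  obtains \<sigma> \<Psi> where "Y = cc \<Psi>" "sub \<Phi> \<sigma> \<Psi>" "F = mc \<Phi> \<sigma> \<Psi>"
proof -
  obtain \<Psi> where "Y = cc \<Psi>" "is_ctx T \<Psi>"
    using assms(1) by (metis homE sub_ctx_right)
  with assms that show ?thesis
    by (metis hom_cc)
qed

text \<open>All composable pairs of representatives have equal composites, so the family whose union
  defines \<open>cmp\<close> is a singleton; the given pair shows that it is inhabited.\<close>

lemma cmp_mc:
  assumes "sub \<Phi> \<sigma> \<Psi>" "sub \<Psi> \<tau> \<Xi>"
  shows "cmp CC (mc \<Psi> \<tau> \<Xi>) (mc \<Phi> \<sigma> \<Psi>) = mc \<Phi> (subst \<sigma> \<circ> \<tau>) \<Xi>"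
proof -
  let ?S = "{mor_class T \<Phi>' (map (subst (tup f)) g) \<Xi>' | \<Phi>' f \<Psi>' g \<Xi>'.
    (\<Phi>', f, \<Psi>') \<in> mc \<Phi> \<sigma> \<Psi> \<and> (\<Psi>', g, \<Xi>') \<in> mc \<Psi> \<tau> \<Xi>}"
  have eq: "mor_class T \<Phi>' (map (subst (tup f)) g) \<Xi>' = mc \<Phi> (subst \<sigma> \<circ> \<tau>) \<Xi>"
    if "(\<Phi>', f, \<Psi>') \<in> mc \<Phi> \<sigma> \<Psi>" "(\<Psi>', g, \<Xi>') \<in> mc \<Psi> \<tau> \<Xi>" for \<Phi>' f \<Psi>' g \<Xi>'
  proof -
    have "map (subst (tup f) \<circ> tup g) [0..<length g] = map (subst (tup f)) g"
      by (metis map_map map_tup)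
    moreover have "length g = length \<Xi>'"
      using that eqc_length[of \<Xi> \<Xi>'] by (simp add: mem_mc)
    ultimately have "mor_class T \<Phi>' (map (subst (tup f)) g) \<Xi>' = mc \<Phi>' (subst (tup f) \<circ> tup g) \<Xi>'"
      by (simp add: mc_def)
    moreover have "eqsub \<Phi> (subst \<sigma> \<circ> \<tau>) (subst (tup f) \<circ> tup g) \<Xi>"
      using that eqsub_comp[of \<Phi> \<sigma> "tup f" \<Psi> \<tau> "tup g" \<Xi>] by (simp add: mem_mc)
    moreover from this have "mc \<Phi> (subst \<sigma> \<circ> \<tau>) \<Xi> = mc \<Phi>' (subst (tup f) \<circ> tup g) \<Xi>'"
      using that by (simp add: mc_eq_iff[OF eqsub_left] mem_mc)
    ultimately show ?thesis
      by simp
  qed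
  let ?f = "map \<sigma> [0..<length \<Psi>]" and ?g = "map \<tau> [0..<length \<Xi>]"
  have "mor_class T \<Phi> (map (subst (tup ?f)) ?g) \<Xi> \<in> ?S"
    unfolding mem_Collect_eq
    by (rule exI[of _ \<Phi>], rule exI[of _ ?f], rule exI[of _ \<Psi>], rule exI[of _ ?g], rule exI[of _ \<Xi>])
      (intro conjI refl mc_self assms)
  moreover have "F = mc \<Phi> (subst \<sigma> \<circ> \<tau>) \<Xi>" if "F \<in> ?S" for F
    using that eq by clarify
  ultimately have "?S = {mc \<Phi> (subst \<sigma> \<circ> \<tau>) \<Xi>}"
    by blast
  moreover have "cmp CC (mc \<Psi> \<tau> \<Xi>) (mc \<Phi> \<sigma> \<Psi>) = \<Union>?S"
    by (simp only: classifying_category_def cat.simps)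
  ultimately show ?thesis
    by simp
qed

lemma ident_cc:
  assumes "is_ctx T \<Gamma>"
  shows "ident CC (cc \<Gamma>) = mc \<Gamma> Var \<Gamma>"
proof -
  have "ident CC (cc \<Gamma>) = (\<Union>\<Delta> \<in> cc \<Gamma>. mc \<Delta> Var \<Delta>)"
    by (simp add: classifying_category_def mc_def)
  also have "\<dots> = (\<Union>\<Delta> \<in> cc \<Gamma>. mc \<Gamma> Var \<Gamma>)"
    using mc_conv[OF sub_Var[OF assms]] by (intro SUP_cong refl) (simp add: mem_cc)
  also have "\<dots> = mc \<Gamma> Var \<Gamma>"
    using assms mem_cc[of \<Gamma> \<Gamma>] by (subst UN_constant) auto
  finally show ?thesis .
qed

lemma category_CC: "category CC"
proof
  fix f
  assume "f \<in> ar CC"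
  then show "src CC f \<in> ob CC" "tgt CC f \<in> ob CC"
    by (auto simp: ar_CC ob_CC src_mc tgt_mc intro: sub_ctx_left sub_ctx_right)
next
  fix X
  assume "X \<in> ob CC"
  then show "ident CC X \<in> hom_set CC X X"
    by (force simp: ob_CC ident_cc intro: mc_hom sub_Var)
next
  fix f X Y g Z
  assume f: "f \<in> hom_set CC X Y" and g: "g \<in> hom_set CC Y Z"
  obtain \<Phi> \<sigma> \<Psi> where \<sigma>: "X = cc \<Phi>" "Y = cc \<Psi>" "sub \<Phi> \<sigma> \<Psi>" "f = mc \<Phi> \<sigma> \<Psi>"
    using f by (rule homE)
  obtain \<tau> \<Xi> where \<tau>: "Z = cc \<Xi>" "sub \<Psi> \<tau> \<Xi>" "g = mc \<Psi> \<tau> \<Xi>"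
    using g \<sigma>(2) sub_ctx_right[OF \<sigma>(3)] by (blast elim: hom_from_cc)
  show "cmp CC g f \<in> hom_set CC X Z"
    using mc_hom[OF sub_comp[OF \<sigma>(3) \<tau>(2)]] \<sigma> \<tau> by (simp add: cmp_mc)
next
  fix f X Y
  assume f: "f \<in> hom_set CC X Y"
  obtain \<Phi> \<sigma> \<Psi> where \<sigma>: "X = cc \<Phi>" "Y = cc \<Psi>" "sub \<Phi> \<sigma> \<Psi>" "f = mc \<Phi> \<sigma> \<Psi>"
    using f by (rule homE)
  note ctx = sub_ctx_left[OF \<sigma>(3)] sub_ctx_right[OF \<sigma>(3)]
  show "cmp CC f (ident CC X) = f" "cmp CC (ident CC Y) f = f"
    using cmp_mc[OF sub_Var \<sigma>(3)] cmp_mc[OF \<sigma>(3) sub_Var] ctx \<sigma> by (simp_all add: ident_cc)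
next
  fix f X Y g Z h W
  assume fgh: "f \<in> hom_set CC X Y" "g \<in> hom_set CC Y Z" "h \<in> hom_set CC Z W"
  obtain \<Phi> \<sigma> \<Psi> where f: "X = cc \<Phi>" "Y = cc \<Psi>" "sub \<Phi> \<sigma> \<Psi>" "f = mc \<Phi> \<sigma> \<Psi>"
    using fgh(1) by (rule homE)
  then obtain \<tau> \<Xi> where g: "Z = cc \<Xi>" "sub \<Psi> \<tau> \<Xi>" "g = mc \<Psi> \<tau> \<Xi>"
    using fgh(2) by (blast elim: hom_from_cc dest: sub_ctx_right)
  then obtain \<rho> \<Omega> where h: "sub \<Xi> \<rho> \<Omega>" "h = mc \<Xi> \<rho> \<Omega>"
    using fgh(3) by (blast elim: hom_from_cc dest: sub_ctx_right)
  show "cmp CC h (cmp CC g f) = cmp CC (cmp CC h g) f"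
    unfolding f(4) g(3) h(2) cmp_mc[OF f(3) g(2)] cmp_mc[OF g(2) h(1)]
      cmp_mc[OF sub_comp[OF f(3) g(2)] h(1)] cmp_mc[OF f(3) sub_comp[OF g(2) h(1)]]
    by (simp only: subst_comp_assoc)
qed

section \<open>Display maps, their pullbacks and the terminal object\<close>

lemma display_maps_mc: "display_maps T = {mc (A # \<Gamma>) (wk (Suc 0)) \<Gamma> | \<Gamma> A. ty \<Gamma> A}"
proof -
  have "map Var [1..<Suc n] = map (wk (Suc 0) :: nat \<Rightarrow> 'f expr) [0..<n]" for n
    by (simp add: map_Suc_upt[symmetric] comp_def wk_def del: upt_Suc)
  then show ?thesis
    by (simp only: display_maps_def mc_def)
qed

text \<open>Reindexing a type is pulling back its display map. In a cone (\<eta>, \<kappa>) all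
  components of \<kappa> but the last are determined by \<eta>; that last one, retyped along the
  commutativity of the cone, extends \<eta> to the mediating map.\<close>

lemma display_pullback_CC:
  assumes "ty \<Gamma> A" "sub \<Delta> \<sigma> \<Gamma>"
  shows "is_pullback CC (mc (subst \<sigma> A # \<Delta>) (wk (Suc 0)) \<Delta>)
    (mc (subst \<sigma> A # \<Delta>) (Var 0 \<cdot> (subst (wk (Suc 0)) \<circ> \<sigma>)) (A # \<Gamma>))
    (mc \<Delta> \<sigma> \<Gamma>) (mc (A # \<Gamma>) (wk (Suc 0)) \<Gamma>)"
proof -
  let ?P = "subst \<sigma> A # \<Delta>" and ?\<sigma> = "Var 0 \<cdot> (subst (wk (Suc 0)) \<circ> \<sigma>)"
  have ty: "ty \<Delta> (subst \<sigma> A)"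
    using assms by (rule sub_ty)
  note disp = sub_wk_1[OF assms(1)] and disp' = sub_wk_1[OF ty] and lift = sub_lift[OF assms(2,1)]
  note subs = disp disp' lift assms(2)
  have "\<exists>!j. j \<in> hom_set CC X (cc ?P) \<and> cmp CC (mc ?P (wk (Suc 0)) \<Delta>) j = h \<and>
      cmp CC (mc ?P ?\<sigma> (A # \<Gamma>)) j = k"
    if hX: "h \<in> hom_set CC X (cc \<Delta>)" and kX: "k \<in> hom_set CC X (cc (A # \<Gamma>))"
      and eq: "cmp CC (mc \<Delta> \<sigma> \<Gamma>) h = cmp CC (mc (A # \<Gamma>) (wk (Suc 0)) \<Gamma>) k" for X h k
  proof -
    obtain \<Phi> where \<Phi>: "X = cc \<Phi>" "is_ctx T \<Phi>"
      using hX by (blast elim: homE dest: sub_ctx_left)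
    obtain \<eta> where h: "sub \<Phi> \<eta> \<Delta>" "h = mc \<Phi> \<eta> \<Delta>"
      using hom_cc[OF hX[unfolded \<Phi>(1)] \<Phi>(2) sub_ctx_left[OF assms(2)]] by blast
    obtain \<kappa> where k: "sub \<Phi> \<kappa> (A # \<Gamma>)" "k = mc \<Phi> \<kappa> (A # \<Gamma>)"
      using hom_cc[OF kX[unfolded \<Phi>(1)] \<Phi>(2) sub_ctx_left[OF disp]] by blast
    have k': "sub \<Phi> (\<kappa> \<circ> Suc) \<Gamma>" "tm \<Phi> (\<kappa> 0) (subst (\<kappa> \<circ> Suc) A)"
      using k(1) by (auto simp: sub_Cons)
    have drop: "sdrop (Suc 0) \<kappa> = \<kappa> \<circ> Suc"
      by (auto simp: sdrop_def comp_def)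
    have eq': "eqsub \<Phi> (subst \<eta> \<circ> \<sigma>) (\<kappa> \<circ> Suc) \<Gamma>"
      using eq unfolding h(2) k(2) cmp_mc[OF h(1) assms(2)] cmp_mc[OF k(1) disp]
      by (simp only: mc_eq_iff[OF sub_comp[OF h(1) assms(2)]] subst_comp_wk drop)
    have tm: "tm \<Phi> (\<kappa> 0) (subst \<eta> (subst \<sigma> A))"
      using HasType_conv[OF k'(2) eqsub_ty[OF assms(1) eqsub_sym[OF eq']]] by (simp add: subst_subst)
    have j: "sub \<Phi> (\<kappa> 0 \<cdot> \<eta>) ?P"
      using h(1) ty tm by (rule sub_scons)
    have "eqsub \<Phi> (\<kappa> 0 \<cdot> (subst \<eta> \<circ> \<sigma>)) \<kappa> (A # \<Gamma>)"
      using eqsub_scons[OF eq' assms(1) EqTerm_refl[of \<Phi> "\<kappa> 0"]] tm scons_eta[of \<kappa>]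
      by (simp add: subst_subst)
    then have jk: "cmp CC (mc ?P ?\<sigma> (A # \<Gamma>)) (mc \<Phi> (\<kappa> 0 \<cdot> \<eta>) ?P) = k"
      unfolding cmp_mc[OF j lift] k(2) by (intro mc_eqI) (simp add: subst_comp_assoc)
    have jh: "cmp CC (mc ?P (wk (Suc 0)) \<Delta>) (mc \<Phi> (\<kappa> 0 \<cdot> \<eta>) ?P) = h"
      unfolding cmp_mc[OF j disp'] h(2) by simp
    \<comment> \<open>Uniqueness: the display map fixes all components except the last, and the
      lifted morphism fixes the last.\<close>
    have "l = mc \<Phi> (\<kappa> 0 \<cdot> \<eta>) ?P"
      if lX: "l \<in> hom_set CC X (cc ?P)" and lh: "cmp CC (mc ?P (wk (Suc 0)) \<Delta>) l = h"
        and lk: "cmp CC (mc ?P ?\<sigma> (A # \<Gamma>)) l = k" for l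
    proof -
      obtain \<iota> where l: "sub \<Phi> \<iota> ?P" "l = mc \<Phi> \<iota> ?P"
        using hom_cc[OF lX[unfolded \<Phi>(1)] \<Phi>(2) sub_ctx_left[OF disp']] by blast
      have drop': "sdrop (Suc 0) \<iota> = \<iota> \<circ> Suc"
        by (auto simp: sdrop_def comp_def)
      have "eqsub \<Phi> (\<iota> \<circ> Suc) \<eta> \<Delta>"
        using mc_eqD[OF sub_comp[OF l(1) disp'] lh[unfolded l(2) h(2) cmp_mc[OF l(1) disp']]]
        by (simp only: subst_comp_wk drop')
      moreover have "eqsub \<Phi> (subst \<iota> \<circ> ?\<sigma>) \<kappa> (A # \<Gamma>)"
        by (rule mc_eqD[OF sub_comp[OF l(1) lift] lk[unfolded l(2) k(2) cmp_mc[OF l(1) lift]]])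
      then have "eqtm \<Phi> (\<iota> 0) (\<kappa> 0) (subst (\<iota> \<circ> Suc) (subst \<sigma> A))"
        by (simp add: eqsub_Cons subst_subst subst_comp_assoc drop')
      ultimately have "eqsub \<Phi> \<iota> (\<kappa> 0 \<cdot> \<eta>) ?P"
        using ty by (simp add: eqsub_Cons)
      then show ?thesis
        unfolding l(2) by (rule mc_eqI)
    qed
    then show ?thesis
      using jk jh mc_hom[OF j] \<Phi> by blast
  qed
  moreover have "cmp CC (mc \<Delta> \<sigma> \<Gamma>) (mc ?P (wk (Suc 0)) \<Delta>) =
      cmp CC (mc (A # \<Gamma>) (wk (Suc 0)) \<Gamma>) (mc ?P ?\<sigma> (A # \<Gamma>))"
    by (simp add: cmp_mc subs)
  ultimately show ?thesis
    using subs unfolding is_pullback_def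
    by (auto simp: src_mc tgt_mc ar_CC)
qed

lemma cc_fibrant: "is_ctx T \<Gamma> \<Longrightarrow> cc \<Gamma> \<in> fibrant CC (display_maps T) (cc [])"
proof (induction \<Gamma>)
  case Nil
  show ?case by (rule fibrant.terminal)
next
  case (Cons A \<Gamma>)
  then have ty: "ty \<Gamma> A"
    by simp
  have "mc (A # \<Gamma>) (wk (Suc 0)) \<Gamma> \<in> display_maps T"
    using ty by (auto simp: display_maps_mc)
  with fibrant.display[OF this, of CC "cc []"] Cons show ?case
    by (simp add: src_mc[OF sub_wk_1[OF ty]] tgt_mc[OF sub_wk_1[OF ty]])
qed

lemma terminal_CC: "X \<in> ob CC \<Longrightarrow> \<exists>!f. f \<in> hom_set CC X (cc [])"
proof -
  assume "X \<in> ob CC"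
  then obtain \<Phi> where X: "X = cc \<Phi>" "is_ctx T \<Phi>"
    by (auto simp: ob_CC)
  \<comment> \<open>No value is read for an empty codomain, so \<open>Var\<close> stands for an
    arbitrary function here.\<close>
  then have "mc \<Phi> Var [] \<in> hom_set CC X (cc [])"
    by (auto intro: mc_hom)
  moreover have "f = mc \<Phi> Var []" if f: "f \<in> hom_set CC X (cc [])" for f
  proof -
    obtain \<sigma> where "f = mc \<Phi> \<sigma> []"
      using hom_cc[OF f[unfolded X(1)] X(2)] by auto
    then show ?thesis
      using mc_eqI[of \<Phi> \<sigma> Var "[]"] X(2) by simp
  qed
  ultimately show ?thesis
    by blast
qed

text \<open>Turns the factorisation of sections into an extension problem for terms. In a square
  from \<sigma> to the display map of C with lower side \<kappa>, a diagonal is \<kappa> extended by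
  a term of \<open>subst \<kappa> C\<close> whose restriction along \<sigma> is the last component
  of the upper side. Hence it suffices to extend single terms along \<sigma>.\<close>

lemma display_category_CC:
  assumes section_factorisation: "\<And>\<Gamma> A b. tm \<Gamma> b A \<Longrightarrow>
    \<exists>B \<sigma>. ty (A # \<Gamma>) B \<and> sub \<Gamma> \<sigma> (B # A # \<Gamma>) \<and> eqsub \<Gamma> (\<sigma> \<circ> Suc) (b \<cdot> Var) (A # \<Gamma>) \<and>
      (\<forall>C c. ty (B # A # \<Gamma>) C \<longrightarrow> tm \<Gamma> c (subst \<sigma> C) \<longrightarrow>
        (\<exists>j. tm (B # A # \<Gamma>) j C \<and> eqtm \<Gamma> (subst \<sigma> j) c (subst \<sigma> C)))"
  shows "display_category CC (display_maps T) (cc [])"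
proof -
  interpret category CC
    by (rule category_CC)
  show ?thesis
  proof
    show "display_maps T \<subseteq> ar CC"
      by (auto simp: display_maps_mc ar_CC intro: sub_wk_1)
    show "cc [] \<in> ob CC"
      by (auto simp: ob_CC)
    show "ob CC \<subseteq> fibrant CC (display_maps T) (cc [])"
      by (auto simp: ob_CC cc_fibrant)
    show "X \<in> ob CC \<Longrightarrow> \<exists>!f. f \<in> hom_set CC X (cc [])" for X
      by (rule terminal_CC)
  next
    fix d f
    assume "d \<in> display_maps T" "f \<in> ar CC" "tgt CC f = tgt CC d"
    then obtain \<Gamma> A where d: "ty \<Gamma> A" "d = mc (A # \<Gamma>) (wk (Suc 0)) \<Gamma>"
      by (auto simp: display_maps_mc)
    then have fX: "f \<in> hom_set CC (src CC f) (cc \<Gamma>)"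
      using \<open>f \<in> ar CC\<close> \<open>tgt CC f = tgt CC d\<close> by (simp add: hom_set_def tgt_mc[OF sub_wk_1])
    then obtain \<Delta> where \<Delta>: "src CC f = cc \<Delta>" "is_ctx T \<Delta>"
      by (rule homE) (blast dest: sub_ctx_left)
    obtain \<sigma> where f: "sub \<Delta> \<sigma> \<Gamma>" "f = mc \<Delta> \<sigma> \<Gamma>"
      using hom_cc[OF fX[unfolded \<Delta>(1)] \<Delta>(2) ty_ctx[OF d(1)]] by blast
    have "mc (subst \<sigma> A # \<Delta>) (wk (Suc 0)) \<Delta> \<in> display_maps T"
      using sub_ty[OF d(1) f(1)] by (auto simp: display_maps_mc)
    then show "\<exists>d' \<in> display_maps T. \<exists>f'. is_pullback CC d' f' f d"
      unfolding d(2) f(2) using display_pullback_CC[OF d(1) f(1)] by (intro bexI exI)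
  next
    fix d s
    assume "d \<in> display_maps T" and s: "s \<in> hom_set CC (tgt CC d) (src CC d)"
      and id: "cmp CC d s = ident CC (tgt CC d)"
    then obtain \<Gamma> A where ty: "ty \<Gamma> A" and d: "d = mc (A # \<Gamma>) (wk (Suc 0)) \<Gamma>"
      by (auto simp: display_maps_mc)
    note disp = sub_wk_1[OF ty]
    obtain \<tau> where \<tau>: "sub \<Gamma> \<tau> (A # \<Gamma>)" "s = mc \<Gamma> \<tau> (A # \<Gamma>)"
      using hom_cc[OF s[unfolded d src_mc[OF disp] tgt_mc[OF disp]] ty_ctx[OF ty] sub_ctx_left[OF disp]]
      by blast
    have drop: "sdrop (Suc 0) \<tau> = \<tau> \<circ> Suc"
      by (auto simp: sdrop_def comp_def)
    \<comment> \<open>Being a section makes all components but the last equal to the identity, so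
      \<open>s\<close> amounts to the term \<open>\<tau> 0\<close> of type A.\<close>
    have \<tau>Suc: "eqsub \<Gamma> (\<tau> \<circ> Suc) Var \<Gamma>"
      using mc_eqD[OF sub_comp[OF \<tau>(1) disp] id[unfolded d \<tau>(2) tgt_mc[OF disp]
          ident_cc[OF ty_ctx[OF ty]] cmp_mc[OF \<tau>(1) disp]]]
      by (simp only: subst_comp_wk drop)
    have \<tau>0: "tm \<Gamma> (\<tau> 0) (subst (\<tau> \<circ> Suc) A)"
      using \<tau>(1) by (simp add: sub_Cons)
    then have b: "tm \<Gamma> (\<tau> 0) A"
      using HasType_conv eqsub_ty[OF ty \<tau>Suc] by simp
    have "eqsub \<Gamma> \<tau> (\<tau> 0 \<cdot> Var) (A # \<Gamma>)"
      using eqsub_scons[OF \<tau>Suc ty EqTerm_refl[OF \<tau>0]] scons_eta[of \<tau>] by simp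
    then have s': "s = mc \<Gamma> (\<tau> 0 \<cdot> Var) (A # \<Gamma>)"
      unfolding \<tau>(2) by (rule mc_eqI)
    obtain B \<sigma> where B: "ty (A # \<Gamma>) B" and \<sigma>: "sub \<Gamma> \<sigma> (B # A # \<Gamma>)"
      and \<sigma>Suc: "eqsub \<Gamma> (\<sigma> \<circ> Suc) (\<tau> 0 \<cdot> Var) (A # \<Gamma>)"
      and lift: "\<And>C c. ty (B # A # \<Gamma>) C \<Longrightarrow> tm \<Gamma> c (subst \<sigma> C) \<Longrightarrow>
        \<exists>j. tm (B # A # \<Gamma>) j C \<and> eqtm \<Gamma> (subst \<sigma> j) c (subst \<sigma> C)"
      using section_factorisation[OF b] by blast
    let ?P = "B # A # \<Gamma>"
    let ?i = "mc \<Gamma> \<sigma> ?P" and ?p = "mc ?P (wk (Suc 0)) (A # \<Gamma>)"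
    have ctx: "is_ctx T ?P" "is_ctx T \<Gamma>"
      using B ty_ctx[OF B] by auto
    have "lifts CC ?i g" if "g \<in> display_maps T" for g
    proof -
      obtain \<Delta> C where C: "ty \<Delta> C" and g: "g = mc (C # \<Delta>) (wk (Suc 0)) \<Delta>"
        using \<open>g \<in> display_maps T\<close> by (auto simp: display_maps_mc)
      note dispC = sub_wk_1[OF C]
      show ?thesis unfolding g
      proof (rule liftsI[OF mc_hom[OF \<sigma>] mc_hom[OF dispC]])
        fix h k
        assume hX: "h \<in> hom_set CC (cc \<Gamma>) (cc (C # \<Delta>))" and kX: "k \<in> hom_set CC (cc ?P) (cc \<Delta>)"
          and eq: "cmp CC (mc (C # \<Delta>) (wk (Suc 0)) \<Delta>) h = cmp CC k ?i"
        obtain \<eta> where h: "sub \<Gamma> \<eta> (C # \<Delta>)" "h = mc \<Gamma> \<eta> (C # \<Delta>)"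
          using hom_cc[OF hX ctx(2) sub_ctx_left[OF dispC]] by blast
        obtain \<kappa> where k: "sub ?P \<kappa> \<Delta>" "k = mc ?P \<kappa> \<Delta>"
          using hom_cc[OF kX ctx(1) ty_ctx[OF C]] by blast
        have drop': "sdrop (Suc 0) \<eta> = \<eta> \<circ> Suc"
          by (auto simp: sdrop_def comp_def)
        \<comment> \<open>Commutativity of the square says that the upper side, without its last
          component, is the restriction of \<kappa>. This is what allows that component to be
          retyped over \<open>subst \<kappa> C\<close>.\<close>
        have eq': "eqsub \<Gamma> (\<eta> \<circ> Suc) (subst \<sigma> \<circ> \<kappa>) \<Delta>"
          using mc_eqD[OF sub_comp[OF h(1) dispC] eq[unfolded h(2) k(2) cmp_mc[OF h(1) dispC]
              cmp_mc[OF \<sigma> k(1)]]]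
          by (simp only: subst_comp_wk drop')
        have "tm \<Gamma> (\<eta> 0) (subst (\<eta> \<circ> Suc) C)"
          using h(1) by (simp add: sub_Cons)
        then have "tm \<Gamma> (\<eta> 0) (subst \<sigma> (subst \<kappa> C))"
          using HasType_conv eqsub_ty[OF C eq'] by (simp add: subst_subst)
        then obtain j where j: "tm ?P j (subst \<kappa> C)"
          and j\<sigma>: "eqtm \<Gamma> (subst \<sigma> j) (\<eta> 0) (subst \<sigma> (subst \<kappa> C))"
          using lift[OF sub_ty[OF C k(1)]] by blast
        have jsub: "sub ?P (j \<cdot> \<kappa>) (C # \<Delta>)"
          using k(1) C j by (rule sub_scons)
        have "eqsub \<Gamma> (subst \<sigma> j \<cdot> (subst \<sigma> \<circ> \<kappa>)) (\<eta> 0 \<cdot> (\<eta> \<circ> Suc)) (C # \<Delta>)"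
          using eqsub_scons[OF eqsub_sym[OF eq'] C] j\<sigma> by (simp add: subst_subst)
        then have "cmp CC (mc ?P (j \<cdot> \<kappa>) (C # \<Delta>)) ?i = h"
          unfolding cmp_mc[OF \<sigma> jsub] h(2) using scons_eta[of \<eta>] by (intro mc_eqI) simp
        moreover have "cmp CC (mc (C # \<Delta>) (wk (Suc 0)) \<Delta>) (mc ?P (j \<cdot> \<kappa>) (C # \<Delta>)) = k"
          unfolding cmp_mc[OF jsub dispC] k(2) by simp
        ultimately show "\<exists>j \<in> hom_set CC (cc ?P) (cc (C # \<Delta>)).
            cmp CC j ?i = h \<and> cmp CC (mc (C # \<Delta>) (wk (Suc 0)) \<Delta>) j = k"
          using mc_hom[OF jsub] by blast
      qed
    qed
    then have "?i \<in> llp CC (display_maps T)"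
      using \<sigma> by (auto simp: llp_def ar_CC)
    moreover have "?p \<in> display_maps T"
      using B by (auto simp: display_maps_mc)
    moreover have "s = cmp CC ?p ?i"
    proof -
      have "sdrop (Suc 0) \<sigma> = \<sigma> \<circ> Suc"
        by (auto simp: sdrop_def comp_def)
      then show ?thesis
        unfolding s' cmp_mc[OF \<sigma> sub_wk_1[OF B]] using mc_eqI[OF eqsub_sym[OF \<sigma>Suc]] by simp
    qed
    ultimately show "\<exists>i \<in> llp CC (display_maps T). \<exists>p \<in> display_maps T.
        src CC i = src CC s \<and> tgt CC i = src CC p \<and> tgt CC p = tgt CC s \<and> s = cmp CC p i"
      using \<tau> sub_wk_1[OF B] \<sigma> src_mc tgt_mc by metis
  qed
qed

end


section \<open>Path induction\<close>

context identity_type_theory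
begin

lemmas subst_norm = weaken_subst subst_subst subst_comp_assoc Id_subst rf_subst up_Suc numeral_eq_Suc
  id_ctx_def on_diag_def at_path_def

lemma id_ctx_subst: "subst_ctx \<sigma> (id_ctx Idt A) = id_ctx Idt (subst \<sigma> A)"
  by (simp add: subst_norm)

text \<open>Naturality of the diagonal (x, x, r(x)) in the ambient context: three bound variables
  before restriction become one after it. It matches the premise on \<open>d\<close> of the
  reindexed elimination rule with the reindexed premise.\<close>

lemma on_diag_up: "subst (on_diag rf (subst \<sigma> A)) \<circ> up 3 \<sigma> = subst (up 1 \<sigma>) \<circ> on_diag rf A"
  by (simp add: subst_norm)

lemma on_diag_up': "subst (up n (on_diag rf (subst \<sigma> A))) \<circ> up (n + 3) \<sigma> =
    subst (up (n + 1) \<sigma>) \<circ> up n (on_diag rf A)"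
  by (simp only: up_up[symmetric] subst_comp_up on_diag_up)

lemma length_id_ctx [simp]: "length (id_ctx Idt A) = 3"
  by (simp add: id_ctx_def)

text \<open>The elimination rule at its universal instance, where endpoints and path are variables.
  Restricted to the diagonal, the resulting term is by \<open>J_subst\<close> the eliminator at (x,
  x, r(x)) over (\<Gamma>, x \<in> A), to which the computation rule applies.\<close>

lemma J_generic:
  assumes ctx: "is_ctx T (\<Theta> @ id_ctx Idt A @ \<Gamma>)"
    and C: "ty (\<Theta> @ id_ctx Idt A @ \<Gamma>) C"
    and d: "tm (subst_ctx (on_diag rf A) \<Theta> @ A # \<Gamma>) d (subst (up (length \<Theta>) (on_diag rf A)) C)"
  obtains j where "tm (\<Theta> @ id_ctx Idt A @ \<Gamma>) j C"
    and "eqtm (subst_ctx (on_diag rf A) \<Theta> @ A # \<Gamma>) (subst (up (length \<Theta>) (on_diag rf A)) j) d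
      (subst (up (length \<Theta>) (on_diag rf A)) C)"
proof -
  let ?n = "length \<Theta>"
  have I: "is_ctx T (id_ctx Idt A @ \<Gamma>)"
    using ctx by (rule is_ctx_append)
  then have A: "ty \<Gamma> A" and \<Gamma>: "is_ctx T \<Gamma>"
    by (auto simp: id_ctx_def)
  \<comment> \<open>Used twice: along \<open>wk 3\<close> to form the generic term and along
    \<open>wk 1\<close> to compute its restriction to the diagonal.\<close>
  have ctx': "is_ctx T (subst_ctx (up 3 \<sigma>) \<Theta> @ id_ctx Idt (subst \<sigma> A) @ \<Phi>)"
    and C': "ty (subst_ctx (up 3 \<sigma>) \<Theta> @ id_ctx Idt (subst \<sigma> A) @ \<Phi>) (subst (up (?n + 3) \<sigma>) C)"
    and d': "tm (subst_ctx (on_diag rf (subst \<sigma> A)) (subst_ctx (up 3 \<sigma>) \<Theta>) @ subst \<sigma> A # \<Phi>)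
      (subst (up (?n + 1) \<sigma>) d)
      (subst (up ?n (on_diag rf (subst \<sigma> A))) (subst (up (?n + 3) \<sigma>) C))"
    if \<sigma>: "sub \<Phi> \<sigma> \<Gamma>" for \<Phi> \<sigma>
  proof -
    have "sub (subst_ctx (up 3 \<sigma>) \<Theta> @ id_ctx Idt (subst \<sigma> A) @ \<Phi>) (up (?n + 3) \<sigma>)
        (\<Theta> @ id_ctx Idt A @ \<Gamma>)"
      using sub_up[OF \<sigma>, of "\<Theta> @ id_ctx Idt A"] ctx by (simp add: subst_ctx_append id_ctx_subst)
    then show "is_ctx T (subst_ctx (up 3 \<sigma>) \<Theta> @ id_ctx Idt (subst \<sigma> A) @ \<Phi>)"
      "ty (subst_ctx (up 3 \<sigma>) \<Theta> @ id_ctx Idt (subst \<sigma> A) @ \<Phi>) (subst (up (?n + 3) \<sigma>) C)"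
      using C by (auto intro: sub_ctx_left sub_ty)
    have "sub (subst_ctx (up 1 \<sigma>) (subst_ctx (on_diag rf A) \<Theta>) @ subst \<sigma> A # \<Phi>) (up (?n + 1) \<sigma>)
        (subst_ctx (on_diag rf A) \<Theta> @ A # \<Gamma>)"
      using sub_up[OF \<sigma>, of "subst_ctx (on_diag rf A) \<Theta> @ [A]"] tm_ctx[OF d]
      by (simp add: subst_ctx_append)
    from sub_tm[OF d this]
    show "tm (subst_ctx (on_diag rf (subst \<sigma> A)) (subst_ctx (up 3 \<sigma>) \<Theta>) @ subst \<sigma> A # \<Phi>)
      (subst (up (?n + 1) \<sigma>) d)
      (subst (up ?n (on_diag rf (subst \<sigma> A))) (subst (up (?n + 3) \<sigma>) C))"
      by (simp only: subst_ctx_subst_ctx subst_subst on_diag_up on_diag_up')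
  qed
  have wk3: "sub (id_ctx Idt A @ \<Gamma>) (wk 3) \<Gamma>"
    using sub_wk_append[OF I] by simp
  have wk1: "sub (A # \<Gamma>) (wk 1) \<Gamma>"
    using sub_wk_1[OF A] by simp
  \<comment> \<open>The ambient context is (\<Gamma>, x, y, u), so all data are weakened by 3 before
    elimination at \<open>Var 2\<close>, \<open>Var 1\<close>, \<open>Var 0\<close>. Instantiating
    at these variables undoes the weakening, and \<Theta> and C reappear unchanged.\<close>
  let ?j = "J (subst (wk 3) A) (subst_ctx (up 3 (wk 3)) \<Theta>) (subst (up (?n + 3) (wk 3)) C)
    (Var 2) (Var 1) (Var 0) (subst (up (?n + 1) (wk 3)) d)"
  have ap: "subst (at_path (Var 2) (Var 1) (Var 0)) \<circ> up 3 (wk 3) = (Var :: nat \<Rightarrow> 'f expr)"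
    by (simp add: subst_norm)
  then have ap': "subst (up ?n (at_path (Var 2) (Var 1) (Var 0))) \<circ> up (?n + 3) (wk 3) =
      (Var :: nat \<Rightarrow> 'f expr)"
    by (simp only: up_up[symmetric] subst_comp_up up_Var)
  have "tm (id_ctx Idt A @ \<Gamma>) (Var 2) (subst (wk 3) A)"
    "tm (id_ctx Idt A @ \<Gamma>) (Var 1) (subst (wk 3) A)"
    "tm (id_ctx Idt A @ \<Gamma>) (Var 0) (Idt (subst (wk 3) A) (Var 2) (Var 1))"
    by (rule tm_Var[OF I]; simp add: subst_norm)+
  from Id_elim[OF this ctx'[OF wk3] C'[OF wk3], of "subst (up (?n + 1) (wk 3)) d"] d'[OF wk3]
  have j: "tm (\<Theta> @ id_ctx Idt A @ \<Gamma>) ?j C"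
    by (simp only: length_subst_ctx subst_ctx_subst_ctx subst_subst ap ap' subst_ctx_Var subst_Var)
  let ?r = "rf (subst (wk 1) A) (Var 0)"
  have ap1: "subst (at_path (Var 0) (Var 0) ?r) \<circ> up 3 (wk 1) = on_diag rf A"
    by (simp add: subst_norm)
  then have ap1': "subst (up ?n (at_path (Var 0) (Var 0) ?r)) \<circ> up (?n + 3) (wk 1) =
      up ?n (on_diag rf A)"
    by (simp only: up_up[symmetric] subst_comp_up up_Var)
  have tup: "subst (tup [Var 0]) \<circ> up 1 (wk 1) = (Var :: nat \<Rightarrow> 'f expr)"
    by (simp add: subst_norm)
  then have tup': "subst (up ?n (tup [Var 0])) \<circ> up (?n + 1) (wk 1) = (Var :: nat \<Rightarrow> 'f expr)"
    by (simp only: up_up[symmetric] subst_comp_up up_Var)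
  \<comment> \<open>The diagonal substitutes for y and u and keeps x, so of the three weakenings one
    survives.\<close>
  have up3: "subst (up k (on_diag rf A)) \<circ> up k (wk 3) = up k (wk 1)" for k
    unfolding subst_comp_up by (simp add: subst_norm)
  have "tm (A # \<Gamma>) (Var 0) (subst (wk 1) A)"
    by (rule tm_Var) (use A \<Gamma> in \<open>simp_all add: subst_norm\<close>)
  from Id_comp[OF this ctx'[OF wk1] C'[OF wk1], of "subst (up (?n + 1) (wk 1)) d"] d'[OF wk1]
  have "eqtm (subst_ctx (on_diag rf A) \<Theta> @ A # \<Gamma>)
      (J (subst (wk 1) A) (subst_ctx (up 3 (wk 1)) \<Theta>) (subst (up (?n + 3) (wk 1)) C)
        (Var 0) (Var 0) ?r (subst (up (?n + 1) (wk 1)) d)) d (subst (up ?n (on_diag rf A)) C)"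
    by (simp only: length_subst_ctx subst_ctx_subst_ctx subst_subst ap1 ap1' tup' subst_Var)
  moreover have "subst (up ?n (on_diag rf A)) ?j =
      J (subst (wk 1) A) (subst_ctx (up 3 (wk 1)) \<Theta>) (subst (up (?n + 3) (wk 1)) C)
        (Var 0) (Var 0) ?r (subst (up (?n + 1) (wk 1)) d)"
    using J_subst[of "subst_ctx (up 3 (wk 3)) \<Theta>" "on_diag rf A" "subst (wk 3) A"
        "subst (up (?n + 3) (wk 3)) C" "Var 2" "Var 1" "Var 0" "subst (up (?n + 1) (wk 3)) d"]
    unfolding length_subst_ctx subst_ctx_subst_ctx subst_subst up3
    by (simp add: subst_norm del: up_Suc)
  ultimately show ?thesis
    using that[OF j] by simp
qed

section \<open>Composition of paths\<close>

lemma wk_ty: "ty \<Gamma> A \<Longrightarrow> is_ctx T (\<Delta> @ \<Gamma>) \<Longrightarrow> n = length \<Delta> \<Longrightarrow> ty (\<Delta> @ \<Gamma>) (subst (wk n) A)"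
  using sub_ty sub_wk_append by blast

lemma id_ctx_is_ctx:
  assumes B: "ty \<Gamma> B"
  shows "is_ctx T (id_ctx Idt B @ \<Gamma>)"
proof -
  have c1: "is_ctx T (B # \<Gamma>)"
    using B ty_ctx[OF B] by simp
  have c2: "is_ctx T (subst (wk 1) B # B # \<Gamma>)"
    using wk_ty[OF B, of "[B]" 1] c1 by simp
  have w2: "ty (subst (wk 1) B # B # \<Gamma>) (subst (wk 2) B)"
    using wk_ty[OF B, of "[subst (wk 1) B, B]" 2] c2 by simp
  have "ty (subst (wk 1) B # B # \<Gamma>) (Idt (subst (wk 2) B) (Var 1) (Var 0))"
    by (rule Id_form[OF w2]; rule tm_Var[OF c2]; simp add: subst_norm)
  then show ?thesis
    using c2 by (simp add: id_ctx_def weaken_subst)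
qed

lemma sub_id_ctx:
  assumes \<sigma>: "sub \<Phi> \<sigma> \<Gamma>" and B: "ty \<Gamma> B"
    and x: "tm \<Phi> x (subst \<sigma> B)" and y: "tm \<Phi> y (subst \<sigma> B)" and u: "tm \<Phi> u (Idt (subst \<sigma> B) x y)"
  shows "sub \<Phi> (u \<cdot> y \<cdot> x \<cdot> \<sigma>) (id_ctx Idt B @ \<Gamma>)"
proof -
  have "is_ctx T (id_ctx Idt B @ \<Gamma>)"
    using B by (rule id_ctx_is_ctx)
  with \<sigma> x y u show ?thesis
    by (auto simp: subst_norm intro!: sub_scons)
qed

text \<open>\<open>m(x, y, u, x0, w)\<close> is a composite of \<open>w \<in> Id(x0, x)\<close> and \<open>u \<in> Id(x, y)\<close>, and
  \<open>m(x, x, r(x), x0, w) = w\<close>. The other unit law only holds up to the path of \<open>composition_unit\<close>.\<close>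

definition is_composition :: "'f ctx \<Rightarrow> 'f expr \<Rightarrow> 'f expr \<Rightarrow> bool" where
  "is_composition \<Gamma> B m \<longleftrightarrow>
    (\<forall>\<Phi> \<sigma> x y u x0 w. sub \<Phi> \<sigma> \<Gamma> \<longrightarrow> tm \<Phi> x (subst \<sigma> B) \<longrightarrow> tm \<Phi> y (subst \<sigma> B) \<longrightarrow>
      tm \<Phi> u (Idt (subst \<sigma> B) x y) \<longrightarrow> tm \<Phi> x0 (subst \<sigma> B) \<longrightarrow> tm \<Phi> w (Idt (subst \<sigma> B) x0 x) \<longrightarrow>
      tm \<Phi> (subst (w \<cdot> x0 \<cdot> u \<cdot> y \<cdot> x \<cdot> \<sigma>) m) (Idt (subst \<sigma> B) x0 y)) \<and>
    (\<forall>\<Phi> \<sigma> x x0 w. sub \<Phi> \<sigma> \<Gamma> \<longrightarrow> tm \<Phi> x (subst \<sigma> B) \<longrightarrow> tm \<Phi> x0 (subst \<sigma> B) \<longrightarrow>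
      tm \<Phi> w (Idt (subst \<sigma> B) x0 x) \<longrightarrow>
      eqtm \<Phi> (subst (w \<cdot> x0 \<cdot> rf (subst \<sigma> B) x \<cdot> x \<cdot> x \<cdot> \<sigma>) m) w (Idt (subst \<sigma> B) x0 x))"

lemma is_composition_tm:
  "is_composition \<Gamma> B m \<Longrightarrow> sub \<Phi> \<sigma> \<Gamma> \<Longrightarrow> tm \<Phi> x (subst \<sigma> B) \<Longrightarrow> tm \<Phi> y (subst \<sigma> B) \<Longrightarrow>
    tm \<Phi> u (Idt (subst \<sigma> B) x y) \<Longrightarrow> tm \<Phi> x0 (subst \<sigma> B) \<Longrightarrow> tm \<Phi> w (Idt (subst \<sigma> B) x0 x) \<Longrightarrow>
    tm \<Phi> (subst (w \<cdot> x0 \<cdot> u \<cdot> y \<cdot> x \<cdot> \<sigma>) m) (Idt (subst \<sigma> B) x0 y)"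
  unfolding is_composition_def by blast

lemma is_composition_rf:
  "is_composition \<Gamma> B m \<Longrightarrow> sub \<Phi> \<sigma> \<Gamma> \<Longrightarrow> tm \<Phi> x (subst \<sigma> B) \<Longrightarrow> tm \<Phi> x0 (subst \<sigma> B) \<Longrightarrow>
    tm \<Phi> w (Idt (subst \<sigma> B) x0 x) \<Longrightarrow>
    eqtm \<Phi> (subst (w \<cdot> x0 \<cdot> rf (subst \<sigma> B) x \<cdot> x \<cdot> x \<cdot> \<sigma>) m) w (Idt (subst \<sigma> B) x0 x)"
  unfolding is_composition_def by blast

text \<open>Elimination of u into Id(x0, y), with x0 and w \<in> Id(x0, x) as parameters. On the
  diagonal the goal is Id(x0, x), where w itself serves; hence the strict law for u = r(x).\<close>

lemma composition_exists:
  assumes B: "ty \<Gamma> B"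
  shows "\<exists>m. is_composition \<Gamma> B m"
proof -
  have \<Gamma>: "is_ctx T \<Gamma>"
    using B by (rule ty_ctx)
  note [simp] = subst_norm nth_Cons'
  \<comment> \<open>After x0 is declared, \<open>Var 0\<close> is x0 and \<open>Var 3\<close> is x,
    with u and y in between.\<close>
  let ?\<Theta> = "[Idt (subst (wk 4) B) (Var 0) (Var 3), subst (wk 3) B]"
  have c3: "is_ctx T (id_ctx Idt B @ \<Gamma>)"
    using B by (rule id_ctx_is_ctx)
  have c4: "is_ctx T ([subst (wk 3) B] @ id_ctx Idt B @ \<Gamma>)"
    using wk_ty[OF B c3] c3 by simp
  have w4: "ty ([subst (wk 3) B] @ id_ctx Idt B @ \<Gamma>) (subst (wk 4) B)"
    using wk_ty[OF B, of "[subst (wk 3) B] @ id_ctx Idt B"] c4 by simp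
  have i4: "ty ([subst (wk 3) B] @ id_ctx Idt B @ \<Gamma>) (Idt (subst (wk 4) B) (Var 0) (Var 3))"
    by (rule Id_form[OF w4]; rule tm_Var[OF c4]; simp)
  have c5: "is_ctx T (?\<Theta> @ id_ctx Idt B @ \<Gamma>)"
    using c4 i4 by simp
  have w5: "ty (?\<Theta> @ id_ctx Idt B @ \<Gamma>) (subst (wk 5) B)"
    using wk_ty[OF B, of "?\<Theta> @ id_ctx Idt B"] c5 by simp
  have C: "ty (?\<Theta> @ id_ctx Idt B @ \<Gamma>) (Idt (subst (wk 5) B) (Var 1) (Var 3))"
    by (rule Id_form[OF w5]; rule tm_Var[OF c5]; simp)
  have c2: "is_ctx T (subst (wk 1) B # B # \<Gamma>)"
    using c3 by simp
  have w2: "ty (subst (wk 1) B # B # \<Gamma>) (subst (wk 2) B)"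
    using wk_ty[OF B, of "[subst (wk 1) B, B]"] c2 by simp
  have "ty (subst (wk 1) B # B # \<Gamma>) (Idt (subst (wk 2) B) (Var 0) (Var 1))"
    by (rule Id_form[OF w2]; rule tm_Var[OF c2]; simp)
  then have c3': "is_ctx T (Idt (subst (wk 2) B) (Var 0) (Var 1) # subst (wk 1) B # B # \<Gamma>)"
    using c2 by simp
  have d: "tm (subst_ctx (on_diag rf B) ?\<Theta> @ B # \<Gamma>) (Var 0)
      (subst (up (length ?\<Theta>) (on_diag rf B)) (Idt (subst (wk 5) B) (Var 1) (Var 3)))"
    by (rule tm_Var) (use c3' in simp_all)
  from J_generic[OF c5 C d] obtain m where
    m: "tm (?\<Theta> @ id_ctx Idt B @ \<Gamma>) m (Idt (subst (wk 5) B) (Var 1) (Var 3))" and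
    m_diag: "eqtm (subst_ctx (on_diag rf B) ?\<Theta> @ B # \<Gamma>)
      (subst (up (length ?\<Theta>) (on_diag rf B)) m) (Var 0)
      (subst (up (length ?\<Theta>) (on_diag rf B)) (Idt (subst (wk 5) B) (Var 1) (Var 3)))"
    by blast
  show ?thesis
    unfolding is_composition_def
  proof (intro exI[of _ m] conjI allI impI)
    fix \<Phi> \<sigma> x y u x0 w
    assume \<sigma>: "sub \<Phi> \<sigma> \<Gamma>" and x: "tm \<Phi> x (subst \<sigma> B)" "tm \<Phi> y (subst \<sigma> B)"
      "tm \<Phi> u (Idt (subst \<sigma> B) x y)" and w: "tm \<Phi> x0 (subst \<sigma> B)" "tm \<Phi> w (Idt (subst \<sigma> B) x0 x)"
    have "sub \<Phi> (w \<cdot> x0 \<cdot> u \<cdot> y \<cdot> x \<cdot> \<sigma>) (?\<Theta> @ id_ctx Idt B @ \<Gamma>)"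
      using sub_id_ctx[OF \<sigma> B x] c5 w by (auto intro!: sub_scons)
    from sub_tm[OF m this]
    show "tm \<Phi> (subst (w \<cdot> x0 \<cdot> u \<cdot> y \<cdot> x \<cdot> \<sigma>) m) (Idt (subst \<sigma> B) x0 y)"
      by simp
  next
    fix \<Phi> \<sigma> x x0 w
    assume \<sigma>: "sub \<Phi> \<sigma> \<Gamma>" and x: "tm \<Phi> x (subst \<sigma> B)"
      "tm \<Phi> x0 (subst \<sigma> B)" "tm \<Phi> w (Idt (subst \<sigma> B) x0 x)"
    have "sub \<Phi> (w \<cdot> x0 \<cdot> x \<cdot> \<sigma>) (Idt (subst (wk 2) B) (Var 0) (Var 1) # subst (wk 1) B # B # \<Gamma>)"
      using \<sigma> x c3' by (auto intro!: sub_scons)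
    from sub_eqtm[OF m_diag, of \<Phi> "w \<cdot> x0 \<cdot> x \<cdot> \<sigma>"] this
    show "eqtm \<Phi> (subst (w \<cdot> x0 \<cdot> rf (subst \<sigma> B) x \<cdot> x \<cdot> x \<cdot> \<sigma>) m) w (Idt (subst \<sigma> B) x0 x)"
      by simp
  qed
qed

text \<open>Elimination of u again. For u = r(x) the strict law of \<open>m\<close> makes both sides
  of the path r(x), so r(r(x)) is available as its value; that this value is attained definitionally
  is what later lets the correcting transport vanish.\<close>

lemma composition_unit:
  assumes B: "ty \<Gamma> B"
    and comp: "is_composition \<Gamma> B m"
  obtains v where
    "\<And>\<Phi> \<sigma> x y u. sub \<Phi> \<sigma> \<Gamma> \<Longrightarrow> tm \<Phi> x (subst \<sigma> B) \<Longrightarrow> tm \<Phi> y (subst \<sigma> B) \<Longrightarrow>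
      tm \<Phi> u (Idt (subst \<sigma> B) x y) \<Longrightarrow>
      tm \<Phi> (subst (u \<cdot> y \<cdot> x \<cdot> \<sigma>) v)
        (Idt (Idt (subst \<sigma> B) x y) (subst (rf (subst \<sigma> B) x \<cdot> x \<cdot> u \<cdot> y \<cdot> x \<cdot> \<sigma>) m) u)"
    "\<And>\<Phi> \<sigma> x. sub \<Phi> \<sigma> \<Gamma> \<Longrightarrow> tm \<Phi> x (subst \<sigma> B) \<Longrightarrow>
      eqtm \<Phi> (subst (rf (subst \<sigma> B) x \<cdot> x \<cdot> x \<cdot> \<sigma>) v)
        (rf (Idt (subst \<sigma> B) x x) (rf (subst \<sigma> B) x))
        (Idt (Idt (subst \<sigma> B) x x) (rf (subst \<sigma> B) x) (rf (subst \<sigma> B) x))"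
proof -
  note [simp] = subst_norm nth_Cons'
  note m = is_composition_tm[OF comp] and m_rf = is_composition_rf[OF comp]
  have c1: "is_ctx T (B # \<Gamma>)"
    using B ty_ctx[OF B] by simp
  have c3: "is_ctx T (id_ctx Idt B @ \<Gamma>)"
    using B by (rule id_ctx_is_ctx)
  have w3: "ty (id_ctx Idt B @ \<Gamma>) (subst (wk 3) B)"
    using wk_ty[OF B c3] by simp
  have wk3: "sub (id_ctx Idt B @ \<Gamma>) (wk 3) \<Gamma>"
    using sub_wk_append[OF c3] by simp
  have x: "tm (id_ctx Idt B @ \<Gamma>) (Var 2) (subst (wk 3) B)"
    and y: "tm (id_ctx Idt B @ \<Gamma>) (Var 1) (subst (wk 3) B)"
    and u: "tm (id_ctx Idt B @ \<Gamma>) (Var 0) (Idt (subst (wk 3) B) (Var 2) (Var 1))"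
    by (rule tm_Var[OF c3]; simp)+
  let ?m = "subst (rf (subst (wk 3) B) (Var 2) \<cdot> Var 2 \<cdot> Var 0 \<cdot> Var 1 \<cdot> Var 2 \<cdot> wk 3) m"
  let ?C = "Idt (Idt (subst (wk 3) B) (Var 2) (Var 1)) ?m (Var 0)"
  have C: "ty (id_ctx Idt B @ \<Gamma>) ?C"
    by (intro Id_form w3 x y u m[OF wk3] Id_intro)
  let ?B = "subst (wk 1) B"
  have wk1: "sub (B # \<Gamma>) (wk 1) \<Gamma>"
    using sub_wk_1[OF B] by simp
  have w1: "ty (B # \<Gamma>) ?B"
    using B wk1 by (rule sub_ty)
  have x1: "tm (B # \<Gamma>) (Var 0) ?B"
    by (rule tm_Var[OF c1]; simp)
  have r1: "tm (B # \<Gamma>) (rf ?B (Var 0)) (Idt ?B (Var 0) (Var 0))"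
    using x1 by (rule Id_intro)
  have i1: "ty (B # \<Gamma>) (Idt ?B (Var 0) (Var 0))"
    by (intro Id_form w1 x1)
  let ?I = "Idt ?B (Var 0) (Var 0)"
  have cI: "is_ctx T (?I # B # \<Gamma>)"
    using c1 i1 by simp
  have sI: "sub (?I # B # \<Gamma>) (wk 1) (B # \<Gamma>)"
    using sub_wk_1[OF i1] by simp
  \<comment> \<open>The left side of the identity type is made a variable, so that r(x) and the
    composite equal to it can be substituted to give an equality of types.\<close>
  have "ty (?I # B # \<Gamma>) (Idt (subst (wk 1) ?I) (Var 0) (subst (wk 1) (rf ?B (Var 0))))"
    by (intro Id_form sub_ty[OF i1 sI] sub_tm[OF r1 sI] tm_Var[OF cI]) simp_all
  from eqsub_ty[OF this eqsub_scons_right[OF EqTerm_sym[OF m_rf[OF wk1 x1 x1 r1]] i1]]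
  have eq: "eqty (B # \<Gamma>) (Idt ?I (rf ?B (Var 0)) (rf ?B (Var 0)))
      (subst (up (length []) (on_diag rf B)) ?C)"
    by simp
  have d: "tm (subst_ctx (on_diag rf B) [] @ B # \<Gamma>) (rf ?I (rf ?B (Var 0)))
      (subst (up (length []) (on_diag rf B)) ?C)"
    using HasType_conv[OF Id_intro[OF r1] eq] by simp
  obtain v where v: "tm (id_ctx Idt B @ \<Gamma>) v ?C"
    and v_diag: "eqtm (B # \<Gamma>) (subst (on_diag rf B) v) (rf ?I (rf ?B (Var 0)))
      (subst (up (length []) (on_diag rf B)) ?C)"
    using J_generic[of "[]", OF _ _ d] c3 C by (simp del: subst_norm) blast
  have v_diag': "eqtm (B # \<Gamma>) (subst (on_diag rf B) v) (rf ?I (rf ?B (Var 0)))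
      (Idt ?I (rf ?B (Var 0)) (rf ?B (Var 0)))"
    using v_diag EqType_sym[OF eq] by (rule EqTerm_conv)
  show ?thesis
  proof (rule that[of v])
    fix \<Phi> \<sigma> x y u
    assume \<sigma>: "sub \<Phi> \<sigma> \<Gamma>" and x: "tm \<Phi> x (subst \<sigma> B)" "tm \<Phi> y (subst \<sigma> B)"
      "tm \<Phi> u (Idt (subst \<sigma> B) x y)"
    from sub_tm[OF v sub_id_ctx[OF \<sigma> B x]]
    show "tm \<Phi> (subst (u \<cdot> y \<cdot> x \<cdot> \<sigma>) v)
        (Idt (Idt (subst \<sigma> B) x y) (subst (rf (subst \<sigma> B) x \<cdot> x \<cdot> u \<cdot> y \<cdot> x \<cdot> \<sigma>) m) u)"
      by simp
  next
    fix \<Phi> \<sigma> x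
    assume \<sigma>: "sub \<Phi> \<sigma> \<Gamma>" and x: "tm \<Phi> x (subst \<sigma> B)"
    from sub_eqtm[OF v_diag' sub_scons[OF \<sigma> B x]]
    show "eqtm \<Phi> (subst (rf (subst \<sigma> B) x \<cdot> x \<cdot> x \<cdot> \<sigma>) v)
        (rf (Idt (subst \<sigma> B) x x) (rf (subst \<sigma> B) x))
        (Idt (Idt (subst \<sigma> B) x x) (rf (subst \<sigma> B) x) (rf (subst \<sigma> B) x))"
      by simp
  qed
qed

section \<open>Transport and path induction from a fixed endpoint\<close>

definition based_path_type :: "'f expr \<Rightarrow> 'f expr \<Rightarrow> 'f expr" where
  "based_path_type B b = Idt (subst (wk 1) B) (subst (wk 1) b) (Var 0)"

lemma based_path_type:
  assumes b: "tm \<Gamma> b B"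
  shows "ty (B # \<Gamma>) (based_path_type B b)"
proof -
  note [simp] = subst_norm nth_Cons'
  have B: "ty \<Gamma> B"
    using b by (rule pre_HasType)
  have wk1: "sub (B # \<Gamma>) (wk 1) \<Gamma>"
    using sub_wk_1[OF B] by simp
  have "is_ctx T (B # \<Gamma>)"
    using B ty_ctx[OF B] by simp
  then have "tm (B # \<Gamma>) (Var 0) (subst (wk 1) B)"
    by (rule tm_Var) simp_all
  then show ?thesis
    unfolding based_path_type_def by (intro Id_form sub_ty[OF B wk1] sub_tm[OF b wk1])
qed

lemma sub_based_path:
  assumes "tm \<Gamma> b B" "sub \<Phi> \<sigma> \<Gamma>" "tm \<Phi> y (subst \<sigma> B)" "tm \<Phi> u (Idt (subst \<sigma> B) (subst \<sigma> b) y)"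
  shows "sub \<Phi> (u \<cdot> y \<cdot> \<sigma>) (based_path_type B b # B # \<Gamma>)"
  using assms based_path_type[OF assms(1)] pre_HasType[OF assms(1)]
  by (auto simp: based_path_type_def subst_norm intro!: sub_scons)

text \<open>C depends on the path as well as on its end, so an element over (x, w) can move along u
  only to a path that ends in y; the composite of w and u is that path. On the diagonal it reduces
  to w, so the fibres over the two paths are equal types and the element itself serves.\<close>

lemma transport_along_path:
  assumes b: "tm \<Gamma> b B" and C: "ty (based_path_type B b # B # \<Gamma>) C"
    and comp: "is_composition \<Gamma> B m"
  obtains t where
    "\<And>\<Phi> \<sigma> x y u w z. sub \<Phi> \<sigma> \<Gamma> \<Longrightarrow> tm \<Phi> x (subst \<sigma> B) \<Longrightarrow> tm \<Phi> y (subst \<sigma> B) \<Longrightarrow>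
      tm \<Phi> u (Idt (subst \<sigma> B) x y) \<Longrightarrow> tm \<Phi> w (Idt (subst \<sigma> B) (subst \<sigma> b) x) \<Longrightarrow>
      tm \<Phi> z (subst (w \<cdot> x \<cdot> \<sigma>) C) \<Longrightarrow>
      tm \<Phi> (subst (z \<cdot> w \<cdot> u \<cdot> y \<cdot> x \<cdot> \<sigma>) t)
        (subst (subst (w \<cdot> subst \<sigma> b \<cdot> u \<cdot> y \<cdot> x \<cdot> \<sigma>) m \<cdot> y \<cdot> \<sigma>) C)"
    "\<And>\<Phi> \<sigma> x w z. sub \<Phi> \<sigma> \<Gamma> \<Longrightarrow> tm \<Phi> x (subst \<sigma> B) \<Longrightarrow>
      tm \<Phi> w (Idt (subst \<sigma> B) (subst \<sigma> b) x) \<Longrightarrow> tm \<Phi> z (subst (w \<cdot> x \<cdot> \<sigma>) C) \<Longrightarrow>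
      eqtm \<Phi> (subst (z \<cdot> w \<cdot> rf (subst \<sigma> B) x \<cdot> x \<cdot> x \<cdot> \<sigma>) t) z (subst (w \<cdot> x \<cdot> \<sigma>) C)"
proof -
  note [simp] = subst_norm nth_Cons'
  note m = is_composition_tm[OF comp] and m_rf = is_composition_rf[OF comp]
  have B: "ty \<Gamma> B"
    using b by (rule pre_HasType)
  have c3: "is_ctx T (id_ctx Idt B @ \<Gamma>)"
    using B by (rule id_ctx_is_ctx)
  let ?W = "Idt (subst (wk 3) B) (subst (wk 3) b) (Var 2)"
  have wk3: "sub (id_ctx Idt B @ \<Gamma>) (wk 3) \<Gamma>"
    using sub_wk_append[OF c3] by simp
  have W: "ty (id_ctx Idt B @ \<Gamma>) ?W"
    by (intro Id_form sub_ty[OF B wk3] sub_tm[OF b wk3] tm_Var[OF c3]) simp_all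
  have c4: "is_ctx T ([?W] @ id_ctx Idt B @ \<Gamma>)"
    using c3 W by simp
  have wk4: "sub ([?W] @ id_ctx Idt B @ \<Gamma>) (wk 4) \<Gamma>"
    using sub_wk_append[of "[?W] @ id_ctx Idt B" \<Gamma>] c4 by simp
  let ?Z = "subst (Var 0 \<cdot> Var 3 \<cdot> wk 4) C"
  have "sub ([?W] @ id_ctx Idt B @ \<Gamma>) (Var 0 \<cdot> Var 3 \<cdot> wk 4) (based_path_type B b # B # \<Gamma>)"
    by (intro sub_based_path[OF b wk4] tm_Var[OF c4]) simp_all
  then have Z: "ty ([?W] @ id_ctx Idt B @ \<Gamma>) ?Z"
    by (rule sub_ty[OF C])
  let ?\<Theta> = "[?Z, ?W]"
  have c5: "is_ctx T (?\<Theta> @ id_ctx Idt B @ \<Gamma>)"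
    using c4 Z by simp
  have wk5: "sub (?\<Theta> @ id_ctx Idt B @ \<Gamma>) (wk 5) \<Gamma>"
    using sub_wk_append[of "?\<Theta> @ id_ctx Idt B" \<Gamma>] c5 by simp
  \<comment> \<open>In the context (x, y, u, w, z) the variables \<open>Var 1\<close>,
    \<open>Var 2\<close>, \<open>Var 3\<close>, \<open>Var 4\<close> are w, u, y, x.\<close>
  let ?m = "subst (Var 1 \<cdot> subst (wk 5) b \<cdot> Var 2 \<cdot> Var 3 \<cdot> Var 4 \<cdot> wk 5) m"
  let ?D = "subst (?m \<cdot> Var 3 \<cdot> wk 5) C"
  have "sub (?\<Theta> @ id_ctx Idt B @ \<Gamma>) (?m \<cdot> Var 3 \<cdot> wk 5) (based_path_type B b # B # \<Gamma>)"
    by (intro sub_based_path[OF b wk5] m[OF wk5] sub_tm[OF b wk5] tm_Var[OF c5]) simp_all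
  then have D: "ty (?\<Theta> @ id_ctx Idt B @ \<Gamma>) ?D"
    by (rule sub_ty[OF C])
  let ?P = "based_path_type B b # B # \<Gamma>"
  let ?Q = "C # ?P"
  have cQ: "is_ctx T ?Q"
    using C ty_ctx[OF C] by simp
  \<comment> \<open>On the diagonal the parameters w and z become exactly a path from
    \<open>b\<close> to x and an element of C over it.\<close>
  have \<Theta>_diag: "subst_ctx (on_diag rf B) ?\<Theta> @ B # \<Gamma> = ?Q"
    by (simp add: based_path_type_def)
  have wkQ: "sub ?Q (wk 3) \<Gamma>"
    using sub_wk_append[of "[C, based_path_type B b, B]" \<Gamma>] cQ by simp
  have x: "tm ?Q (Var 2) (subst (wk 3) B)"
    by (rule tm_Var[OF cQ]) simp_all
  have w: "tm ?Q (Var 1) (Idt (subst (wk 3) B) (subst (wk 3) b) (Var 2))"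
    by (rule tm_Var[OF cQ]) (simp_all add: based_path_type_def)
  have "sub ?Q (Var 2 \<cdot> wk 3) (B # \<Gamma>)"
    using sub_scons[OF wkQ B x] .
  moreover have "eqtm ?Q (Var 1)
      (subst (Var 1 \<cdot> subst (wk 3) b \<cdot> rf (subst (wk 3) B) (Var 2) \<cdot> Var 2 \<cdot> Var 2 \<cdot> wk 3) m)
      (subst (Var 2 \<cdot> wk 3) (based_path_type B b))"
    using EqTerm_sym[OF m_rf[OF wkQ x sub_tm[OF b wkQ] w]] by (simp add: based_path_type_def)
  ultimately have "eqsub ?Q (Var 1 \<cdot> Var 2 \<cdot> wk 3)
    (subst (Var 1 \<cdot> subst (wk 3) b \<cdot> rf (subst (wk 3) B) (Var 2) \<cdot> Var 2 \<cdot> Var 2 \<cdot> wk 3) m \<cdot> Var 2 \<cdot> wk 3) ?P"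
    by (intro eqsub_scons[OF eqsub_refl based_path_type[OF b]])
  from eqsub_ty[OF C this]
  have eq: "eqty ?Q (subst (wk 1) C) (subst (up (length ?\<Theta>) (on_diag rf B)) ?D)"
    by simp
  have "tm ?Q (Var 0) (subst (wk 1) C)"
    by (rule tm_Var[OF cQ]) simp_all
  from HasType_conv[OF this eq]
  have d: "tm (subst_ctx (on_diag rf B) ?\<Theta> @ B # \<Gamma>) (Var 0)
      (subst (up (length ?\<Theta>) (on_diag rf B)) ?D)"
    unfolding \<Theta>_diag .
  obtain t where t: "tm (?\<Theta> @ id_ctx Idt B @ \<Gamma>) t ?D"
    and t_diag: "eqtm ?Q (subst (up (length ?\<Theta>) (on_diag rf B)) t) (Var 0)
      (subst (up (length ?\<Theta>) (on_diag rf B)) ?D)"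
    using J_generic[OF c5 D d] unfolding \<Theta>_diag by blast
  have t_diag': "eqtm ?Q (subst (up (length ?\<Theta>) (on_diag rf B)) t) (Var 0) (subst (wk 1) C)"
    using t_diag EqType_sym[OF eq] by (rule EqTerm_conv)
  show ?thesis
  proof (rule that[of t])
    fix \<Phi> \<sigma> x y u w z
    assume \<sigma>: "sub \<Phi> \<sigma> \<Gamma>" and x: "tm \<Phi> x (subst \<sigma> B)" "tm \<Phi> y (subst \<sigma> B)"
      "tm \<Phi> u (Idt (subst \<sigma> B) x y)" and w: "tm \<Phi> w (Idt (subst \<sigma> B) (subst \<sigma> b) x)"
      and z: "tm \<Phi> z (subst (w \<cdot> x \<cdot> \<sigma>) C)"
    have "sub \<Phi> (z \<cdot> w \<cdot> u \<cdot> y \<cdot> x \<cdot> \<sigma>) (?\<Theta> @ id_ctx Idt B @ \<Gamma>)"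
      using sub_id_ctx[OF \<sigma> B x] c5 w z by (auto intro!: sub_scons)
    from sub_tm[OF t this]
    show "tm \<Phi> (subst (z \<cdot> w \<cdot> u \<cdot> y \<cdot> x \<cdot> \<sigma>) t)
        (subst (subst (w \<cdot> subst \<sigma> b \<cdot> u \<cdot> y \<cdot> x \<cdot> \<sigma>) m \<cdot> y \<cdot> \<sigma>) C)"
      by simp
  next
    fix \<Phi> \<sigma> x w z
    assume \<sigma>: "sub \<Phi> \<sigma> \<Gamma>" and x: "tm \<Phi> x (subst \<sigma> B)"
      and w: "tm \<Phi> w (Idt (subst \<sigma> B) (subst \<sigma> b) x)" and z: "tm \<Phi> z (subst (w \<cdot> x \<cdot> \<sigma>) C)"
    from sub_eqtm[OF t_diag' sub_scons[OF sub_based_path[OF b \<sigma> x w] C z]]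
    show "eqtm \<Phi> (subst (z \<cdot> w \<cdot> rf (subst \<sigma> B) x \<cdot> x \<cdot> x \<cdot> \<sigma>) t) z (subst (w \<cdot> x \<cdot> \<sigma>) C)"
      by simp
  qed
qed

text \<open>Transport with y fixed along r \<in> Id(p, q), i.e. elimination in the identity type of
  Id(b, y). The congruence is stated because, at reflexivity, the arguments supplied for p, r and z
  only equal r(b), r(r(b)) and c definitionally, while q is r(b) literally. It holds since
  \<open>t\<close> is one term over variables.\<close>

lemma transport_along_unit:
  assumes b: "tm \<Gamma> b B" and C: "ty (based_path_type B b # B # \<Gamma>) C"
  obtains t where
    "\<And>\<Phi> \<sigma> y p p' q r r' z z'. sub \<Phi> \<sigma> \<Gamma> \<Longrightarrow> tm \<Phi> y (subst \<sigma> B) \<Longrightarrow>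
      eqtm \<Phi> p p' (Idt (subst \<sigma> B) (subst \<sigma> b) y) \<Longrightarrow> tm \<Phi> q (Idt (subst \<sigma> B) (subst \<sigma> b) y) \<Longrightarrow>
      eqtm \<Phi> r r' (Idt (Idt (subst \<sigma> B) (subst \<sigma> b) y) p q) \<Longrightarrow>
      eqtm \<Phi> z z' (subst (p \<cdot> y \<cdot> \<sigma>) C) \<Longrightarrow>
      eqtm \<Phi> (subst (z \<cdot> r \<cdot> q \<cdot> p \<cdot> y \<cdot> \<sigma>) t) (subst (z' \<cdot> r' \<cdot> q \<cdot> p' \<cdot> y \<cdot> \<sigma>) t)
        (subst (q \<cdot> y \<cdot> \<sigma>) C)"
    "\<And>\<Phi> \<sigma> y p z. sub \<Phi> \<sigma> \<Gamma> \<Longrightarrow> tm \<Phi> y (subst \<sigma> B) \<Longrightarrow>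
      tm \<Phi> p (Idt (subst \<sigma> B) (subst \<sigma> b) y) \<Longrightarrow> tm \<Phi> z (subst (p \<cdot> y \<cdot> \<sigma>) C) \<Longrightarrow>
      eqtm \<Phi> (subst (z \<cdot> rf (Idt (subst \<sigma> B) (subst \<sigma> b) y) p \<cdot> p \<cdot> p \<cdot> y \<cdot> \<sigma>) t) z
        (subst (p \<cdot> y \<cdot> \<sigma>) C)"
proof -
  note [simp] = subst_norm nth_Cons'
  have B: "ty \<Gamma> B"
    using b by (rule pre_HasType)
  let ?I = "based_path_type B b"
  have I: "ty (B # \<Gamma>) ?I"
    using b by (rule based_path_type)
  have c4: "is_ctx T (id_ctx Idt ?I @ B # \<Gamma>)"
    using I by (rule id_ctx_is_ctx)
  have wk4: "sub (id_ctx Idt ?I @ B # \<Gamma>) (wk 4) \<Gamma>"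
    using sub_wk_append[of "id_ctx Idt ?I @ [B]" \<Gamma>] c4 by simp
  let ?Z = "subst (Var 2 \<cdot> Var 3 \<cdot> wk 4) C"
  have "sub (id_ctx Idt ?I @ B # \<Gamma>) (Var 2 \<cdot> Var 3 \<cdot> wk 4) (?I # B # \<Gamma>)"
    by (intro sub_based_path[OF b wk4] tm_Var[OF c4]) (simp_all add: based_path_type_def)
  then have Z: "ty (id_ctx Idt ?I @ B # \<Gamma>) ?Z"
    by (rule sub_ty[OF C])
  let ?\<Theta> = "[?Z]"
  have c5: "is_ctx T (?\<Theta> @ id_ctx Idt ?I @ B # \<Gamma>)"
    using c4 Z by simp
  have wk5: "sub (?\<Theta> @ id_ctx Idt ?I @ B # \<Gamma>) (wk 5) \<Gamma>"
    using sub_wk_append[of "?\<Theta> @ id_ctx Idt ?I @ [B]" \<Gamma>] c5 by simp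
  let ?D = "subst (Var 2 \<cdot> Var 4 \<cdot> wk 5) C"
  have "sub (?\<Theta> @ id_ctx Idt ?I @ B # \<Gamma>) (Var 2 \<cdot> Var 4 \<cdot> wk 5) (?I # B # \<Gamma>)"
    by (intro sub_based_path[OF b wk5] tm_Var[OF c5]) (simp_all add: based_path_type_def)
  then have D: "ty (?\<Theta> @ id_ctx Idt ?I @ B # \<Gamma>) ?D"
    by (rule sub_ty[OF C])
  let ?Q = "C # ?I # B # \<Gamma>"
  have cQ: "is_ctx T ?Q"
    using C ty_ctx[OF C] by simp
  have \<Theta>_diag: "subst_ctx (on_diag rf ?I) ?\<Theta> @ ?I # B # \<Gamma> = ?Q"
    by simp
  have D_diag: "subst (up (length ?\<Theta>) (on_diag rf ?I)) ?D = subst (wk 1) C"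
    by simp
  have "tm ?Q (Var 0) (subst (wk 1) C)"
    by (rule tm_Var[OF cQ]) simp_all
  then have d: "tm (subst_ctx (on_diag rf ?I) ?\<Theta> @ ?I # B # \<Gamma>) (Var 0)
      (subst (up (length ?\<Theta>) (on_diag rf ?I)) ?D)"
    unfolding \<Theta>_diag D_diag .
  obtain t where t: "tm (?\<Theta> @ id_ctx Idt ?I @ B # \<Gamma>) t ?D"
    and t_diag: "eqtm ?Q (subst (up (length ?\<Theta>) (on_diag rf ?I)) t) (Var 0) (subst (wk 1) C)"
    using J_generic[OF c5 D d] unfolding \<Theta>_diag D_diag by blast
  show ?thesis
  proof (rule that[of t])
    fix \<Phi> \<sigma> y p p' q r r' z z'
    assume \<sigma>: "sub \<Phi> \<sigma> \<Gamma>" and y: "tm \<Phi> y (subst \<sigma> B)"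
      and p: "eqtm \<Phi> p p' (Idt (subst \<sigma> B) (subst \<sigma> b) y)"
      and q: "tm \<Phi> q (Idt (subst \<sigma> B) (subst \<sigma> b) y)"
      and r: "eqtm \<Phi> r r' (Idt (Idt (subst \<sigma> B) (subst \<sigma> b) y) p q)"
      and z: "eqtm \<Phi> z z' (subst (p \<cdot> y \<cdot> \<sigma>) C)"
    have "eqsub \<Phi> (y \<cdot> \<sigma>) (y \<cdot> \<sigma>) (B # \<Gamma>)"
      by (rule eqsub_refl[OF sub_scons[OF \<sigma> B y]])
    then have "eqsub \<Phi> (z \<cdot> r \<cdot> q \<cdot> p \<cdot> y \<cdot> \<sigma>) (z' \<cdot> r' \<cdot> q \<cdot> p' \<cdot> y \<cdot> \<sigma>)
        (?\<Theta> @ id_ctx Idt ?I @ B # \<Gamma>)"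
      using p r z c5 EqTerm_refl[OF q] by (auto simp: based_path_type_def intro!: eqsub_scons)
    from eqsub_tm[OF t this]
    show "eqtm \<Phi> (subst (z \<cdot> r \<cdot> q \<cdot> p \<cdot> y \<cdot> \<sigma>) t) (subst (z' \<cdot> r' \<cdot> q \<cdot> p' \<cdot> y \<cdot> \<sigma>) t)
        (subst (q \<cdot> y \<cdot> \<sigma>) C)"
      by simp
  next
    fix \<Phi> \<sigma> y p z
    assume \<sigma>: "sub \<Phi> \<sigma> \<Gamma>" and y: "tm \<Phi> y (subst \<sigma> B)"
      and p: "tm \<Phi> p (Idt (subst \<sigma> B) (subst \<sigma> b) y)" and z: "tm \<Phi> z (subst (p \<cdot> y \<cdot> \<sigma>) C)"
    from sub_eqtm[OF t_diag sub_scons[OF sub_based_path[OF b \<sigma> y p] C z]]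
    show "eqtm \<Phi> (subst (z \<cdot> rf (Idt (subst \<sigma> B) (subst \<sigma> b) y) p \<cdot> p \<cdot> p \<cdot> y \<cdot> \<sigma>) t) z
        (subst (p \<cdot> y \<cdot> \<sigma>) C)"
      by (simp add: based_path_type_def)
  qed
qed

text \<open>Path induction with one endpoint fixed. The term \<open>c\<close> is first transported along \<open>u\<close> to the
  fibre over \<open>m(u, r(b))\<close>, and then along the unit law \<open>v \<in> Id(m(u, r(b)), u)\<close>.\<close>

lemma based_path_induction:
  assumes b: "tm \<Gamma> b B" and C: "ty (based_path_type B b # B # \<Gamma>) C"
    and c: "tm \<Gamma> c (subst (rf B b \<cdot> b \<cdot> Var) C)"
  obtains j where "tm (based_path_type B b # B # \<Gamma>) j C"
    and "eqtm \<Gamma> (subst (rf B b \<cdot> b \<cdot> Var) j) c (subst (rf B b \<cdot> b \<cdot> Var) C)"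
proof -
  note [simp] = subst_norm nth_Cons'
  have B: "ty \<Gamma> B"
    using b by (rule pre_HasType)
  obtain m where comp: "is_composition \<Gamma> B m"
    using composition_exists[OF B] by blast
  note m = is_composition_tm[OF comp]
  obtain v where
    v: "\<And>\<Phi> \<sigma> x y u. sub \<Phi> \<sigma> \<Gamma> \<Longrightarrow> tm \<Phi> x (subst \<sigma> B) \<Longrightarrow> tm \<Phi> y (subst \<sigma> B) \<Longrightarrow>
      tm \<Phi> u (Idt (subst \<sigma> B) x y) \<Longrightarrow>
      tm \<Phi> (subst (u \<cdot> y \<cdot> x \<cdot> \<sigma>) v)
        (Idt (Idt (subst \<sigma> B) x y) (subst (rf (subst \<sigma> B) x \<cdot> x \<cdot> u \<cdot> y \<cdot> x \<cdot> \<sigma>) m) u)"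
    and v_rf: "\<And>\<Phi> \<sigma> x. sub \<Phi> \<sigma> \<Gamma> \<Longrightarrow> tm \<Phi> x (subst \<sigma> B) \<Longrightarrow>
      eqtm \<Phi> (subst (rf (subst \<sigma> B) x \<cdot> x \<cdot> x \<cdot> \<sigma>) v)
        (rf (Idt (subst \<sigma> B) x x) (rf (subst \<sigma> B) x))
        (Idt (Idt (subst \<sigma> B) x x) (rf (subst \<sigma> B) x) (rf (subst \<sigma> B) x))"
    by (rule composition_unit[OF B comp]) (rule that; blast)
  obtain t where
    t: "\<And>\<Phi> \<sigma> x y u w z. sub \<Phi> \<sigma> \<Gamma> \<Longrightarrow> tm \<Phi> x (subst \<sigma> B) \<Longrightarrow> tm \<Phi> y (subst \<sigma> B) \<Longrightarrow>
      tm \<Phi> u (Idt (subst \<sigma> B) x y) \<Longrightarrow> tm \<Phi> w (Idt (subst \<sigma> B) (subst \<sigma> b) x) \<Longrightarrow>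
      tm \<Phi> z (subst (w \<cdot> x \<cdot> \<sigma>) C) \<Longrightarrow>
      tm \<Phi> (subst (z \<cdot> w \<cdot> u \<cdot> y \<cdot> x \<cdot> \<sigma>) t)
        (subst (subst (w \<cdot> subst \<sigma> b \<cdot> u \<cdot> y \<cdot> x \<cdot> \<sigma>) m \<cdot> y \<cdot> \<sigma>) C)"
    and t_rf: "\<And>\<Phi> \<sigma> x w z. sub \<Phi> \<sigma> \<Gamma> \<Longrightarrow> tm \<Phi> x (subst \<sigma> B) \<Longrightarrow>
      tm \<Phi> w (Idt (subst \<sigma> B) (subst \<sigma> b) x) \<Longrightarrow> tm \<Phi> z (subst (w \<cdot> x \<cdot> \<sigma>) C) \<Longrightarrow>
      eqtm \<Phi> (subst (z \<cdot> w \<cdot> rf (subst \<sigma> B) x \<cdot> x \<cdot> x \<cdot> \<sigma>) t) z (subst (w \<cdot> x \<cdot> \<sigma>) C)"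
    by (rule transport_along_path[OF b C comp]) (rule that; blast)
  obtain s where
    s_cong: "\<And>\<Phi> \<sigma> y p p' q r r' z z'. sub \<Phi> \<sigma> \<Gamma> \<Longrightarrow> tm \<Phi> y (subst \<sigma> B) \<Longrightarrow>
      eqtm \<Phi> p p' (Idt (subst \<sigma> B) (subst \<sigma> b) y) \<Longrightarrow> tm \<Phi> q (Idt (subst \<sigma> B) (subst \<sigma> b) y) \<Longrightarrow>
      eqtm \<Phi> r r' (Idt (Idt (subst \<sigma> B) (subst \<sigma> b) y) p q) \<Longrightarrow>
      eqtm \<Phi> z z' (subst (p \<cdot> y \<cdot> \<sigma>) C) \<Longrightarrow>
      eqtm \<Phi> (subst (z \<cdot> r \<cdot> q \<cdot> p \<cdot> y \<cdot> \<sigma>) s) (subst (z' \<cdot> r' \<cdot> q \<cdot> p' \<cdot> y \<cdot> \<sigma>) s)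
        (subst (q \<cdot> y \<cdot> \<sigma>) C)"
    and s_rf: "\<And>\<Phi> \<sigma> y p z. sub \<Phi> \<sigma> \<Gamma> \<Longrightarrow> tm \<Phi> y (subst \<sigma> B) \<Longrightarrow>
      tm \<Phi> p (Idt (subst \<sigma> B) (subst \<sigma> b) y) \<Longrightarrow> tm \<Phi> z (subst (p \<cdot> y \<cdot> \<sigma>) C) \<Longrightarrow>
      eqtm \<Phi> (subst (z \<cdot> rf (Idt (subst \<sigma> B) (subst \<sigma> b) y) p \<cdot> p \<cdot> p \<cdot> y \<cdot> \<sigma>) s) z
        (subst (p \<cdot> y \<cdot> \<sigma>) C)"
    by (rule transport_along_unit[OF b C]) (rule that; blast)
  \<comment> \<open>Typing is the congruence at reflexive equalities, by the presuppositions of an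
    equality judgement.\<close>
  have s: "tm \<Phi> (subst (z \<cdot> r \<cdot> q \<cdot> p \<cdot> y \<cdot> \<sigma>) s) (subst (q \<cdot> y \<cdot> \<sigma>) C)"
    if "sub \<Phi> \<sigma> \<Gamma>" "tm \<Phi> y (subst \<sigma> B)" "tm \<Phi> p (Idt (subst \<sigma> B) (subst \<sigma> b) y)"
      "tm \<Phi> q (Idt (subst \<sigma> B) (subst \<sigma> b) y)"
      "tm \<Phi> r (Idt (Idt (subst \<sigma> B) (subst \<sigma> b) y) p q)" "tm \<Phi> z (subst (p \<cdot> y \<cdot> \<sigma>) C)"
    for \<Phi> \<sigma> y p q r z
    using pre_EqTerm[OF s_cong[OF that(1,2) EqTerm_refl[OF that(3)] that(4)
          EqTerm_refl[OF that(5)] EqTerm_refl[OF that(6)]]] by blast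
  let ?P = "based_path_type B b # B # \<Gamma>"
  have cP: "is_ctx T ?P"
    using C by (rule ty_ctx)
  have wk2: "sub ?P (wk 2) \<Gamma>"
    using sub_wk_append[of "[based_path_type B b, B]" \<Gamma>] cP by simp
  let ?B = "subst (wk 2) B" and ?b = "subst (wk 2) b"
  \<comment> \<open>Over (\<Gamma>, y, u), where \<open>Var 1\<close> is y and \<open>Var 0\<close>
    is u: the composite of r(b) and u, its unit path, and \<open>c\<close> transported along
    u.\<close>
  let ?m = "subst (rf ?B ?b \<cdot> ?b \<cdot> Var 0 \<cdot> Var 1 \<cdot> ?b \<cdot> wk 2) m"
  let ?v = "subst (Var 0 \<cdot> Var 1 \<cdot> ?b \<cdot> wk 2) v"
  let ?t = "subst (subst (wk 2) c \<cdot> rf ?B ?b \<cdot> Var 0 \<cdot> Var 1 \<cdot> ?b \<cdot> wk 2) t"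
  let ?j = "subst (?t \<cdot> ?v \<cdot> Var 0 \<cdot> ?m \<cdot> Var 1 \<cdot> wk 2) s"
  have y: "tm ?P (Var 1) ?B"
    by (rule tm_Var[OF cP]) simp_all
  have u: "tm ?P (Var 0) (Idt ?B ?b (Var 1))"
    by (rule tm_Var[OF cP]) (simp_all add: based_path_type_def)
  note b2 = sub_tm[OF b wk2]
  note r2 = Id_intro[OF b2]
  have "tm ?P (subst (wk 2) c) (subst (rf ?B ?b \<cdot> ?b \<cdot> wk 2) C)"
    using sub_tm[OF c wk2] by simp
  then have "tm ?P ?j (subst (Var 0 \<cdot> Var 1 \<cdot> wk 2) C)"
    by (intro s[OF wk2] m[OF wk2] v[OF wk2] t[OF wk2] y u b2 r2)
  then have j: "tm ?P ?j C"
    by simp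
  note Var = sub_Var[OF ty_ctx[OF B]]
  \<comment> \<open>The same ingredients at y = b and u = r(b). They reduce to r(b), r(r(b)) and
    \<open>c\<close>.\<close>
  let ?m0 = "subst (rf B b \<cdot> b \<cdot> rf B b \<cdot> b \<cdot> b \<cdot> Var) m"
  let ?v0 = "subst (rf B b \<cdot> b \<cdot> b \<cdot> Var) v"
  let ?t0 = "subst (c \<cdot> rf B b \<cdot> rf B b \<cdot> b \<cdot> b \<cdot> Var) t"
  have r: "tm \<Gamma> (rf B b) (Idt B b b)"
    using b by (rule Id_intro)
  \<comment> \<open>The equations run from the reduced terms to the computed ones, because
    \<open>s_cong\<close> types r and z over its left argument p, which is then literally
    r(b).\<close>
  have m0: "eqtm \<Gamma> (rf B b) ?m0 (Idt B b b)"
    using EqTerm_sym[OF is_composition_rf[OF comp Var, of b b "rf B b"]] b r by simp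
  have v0: "eqtm \<Gamma> (rf (Idt B b b) (rf B b)) ?v0 (Idt (Idt B b b) (rf B b) (rf B b))"
    using EqTerm_sym[OF v_rf[OF Var, of b]] b by simp
  have t0: "eqtm \<Gamma> c ?t0 (subst (rf B b \<cdot> b \<cdot> Var) C)"
    using EqTerm_sym[OF t_rf[OF Var, of b "rf B b" c]] b r c by simp
  have "eqtm \<Gamma> (subst (c \<cdot> rf (Idt B b b) (rf B b) \<cdot> rf B b \<cdot> rf B b \<cdot> b \<cdot> Var) s)
      (subst (?t0 \<cdot> ?v0 \<cdot> rf B b \<cdot> ?m0 \<cdot> b \<cdot> Var) s) (subst (rf B b \<cdot> b \<cdot> Var) C)"
    using s_cong[OF Var, of b "rf B b" ?m0 "rf B b" "rf (Idt B b b) (rf B b)" ?v0 c ?t0] b r m0 v0 t0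
    by simp
  moreover have "eqtm \<Gamma> (subst (c \<cdot> rf (Idt B b b) (rf B b) \<cdot> rf B b \<cdot> rf B b \<cdot> b \<cdot> Var) s) c
      (subst (rf B b \<cdot> b \<cdot> Var) C)"
    using s_rf[OF Var, of b "rf B b" c] b r c by simp
  ultimately have "eqtm \<Gamma> (subst (?t0 \<cdot> ?v0 \<cdot> rf B b \<cdot> ?m0 \<cdot> b \<cdot> Var) s) c
      (subst (rf B b \<cdot> b \<cdot> Var) C)"
    by (blast intro: EqTerm_trans EqTerm_sym)
  moreover have "subst (rf B b \<cdot> b \<cdot> Var) ?j = subst (?t0 \<cdot> ?v0 \<cdot> rf B b \<cdot> ?m0 \<cdot> b \<cdot> Var) s"
    by simp
  ultimately show ?thesis
    using that[OF j] by simp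
qed

text \<open>The left factor of the section given by \<open>b\<close> is the tuple with r(b) as last
  component; based path induction is precisely the extension property demanded of it.\<close>

lemma display_category_classifying: "display_category CC (display_maps T) (cc [])"
proof (rule display_category_CC)
  fix \<Gamma> A b
  assume b: "tm \<Gamma> b A"
  then have A: "ty \<Gamma> A"
    by (rule pre_HasType)
  have Var: "sub \<Gamma> Var \<Gamma>"
    using ty_ctx[OF A] by (rule sub_Var)
  have \<sigma>: "sub \<Gamma> (rf A b \<cdot> b \<cdot> Var) (based_path_type A b # A # \<Gamma>)"
    by (rule sub_based_path[OF b Var]) (use b Id_intro[OF b] in simp_all)
  then have "eqsub \<Gamma> (b \<cdot> Var) (b \<cdot> Var) (A # \<Gamma>)"
    by (auto simp: sub_Cons intro: eqsub_refl sub_scons A)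
  with \<sigma> show "\<exists>B \<sigma>. ty (A # \<Gamma>) B \<and> sub \<Gamma> \<sigma> (B # A # \<Gamma>) \<and> eqsub \<Gamma> (\<sigma> \<circ> Suc) (b \<cdot> Var) (A # \<Gamma>) \<and>
      (\<forall>C c. ty (B # A # \<Gamma>) C \<longrightarrow> tm \<Gamma> c (subst \<sigma> C) \<longrightarrow>
        (\<exists>j. tm (B # A # \<Gamma>) j C \<and> eqtm \<Gamma> (subst \<sigma> j) c (subst \<sigma> C)))"
    by (intro exI[of _ "based_path_type A b"] exI[of _ "rf A b \<cdot> b \<cdot> Var"])
      (auto intro: based_path_type[OF b] elim: based_path_induction[OF b])
qed

end


section \<open>The identity type weak factorisation system\<close>

theorem theorem4p1:
  fixes T :: "'f judgement set"
    and Idt :: "'f expr \<Rightarrow> 'f expr \<Rightarrow> 'f expr \<Rightarrow> 'f expr"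
    and rf :: "'f expr \<Rightarrow> 'f expr \<Rightarrow> 'f expr"
    and J :: "'f expr \<Rightarrow> 'f ctx \<Rightarrow> 'f expr \<Rightarrow> 'f expr \<Rightarrow> 'f expr \<Rightarrow> 'f expr \<Rightarrow> 'f expr \<Rightarrow> 'f expr"
    and \<A> \<B> :: "'f mor set set"
  assumes "identity_type_theory T Idt rf J"
    and "\<A> = llp (classifying_category T) (display_maps T)"
    and "\<B> = rlp (classifying_category T) \<A>"
  shows "weak_factorisation_system (classifying_category T) \<A> \<B>"
proof -
  interpret identity_type_theory T Idt rf J
    by (fact assms(1))
  interpret display_category "classifying_category T" "display_maps T" "cc []"
    by (rule display_category_classifying)
  show ?thesis
    unfolding assms(2,3) by (rule wfs)
qed

end
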